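(* The function $\zeta_h(s) := \sum_{n=1}^\infty h_n n^{-s}$ ($\Re s>1$) has an analytic continuation to the whole complex plane, except at the pole $s=1$ of order $2$ and at simple poles $s = 1-2n$ ($n=1,2,3,\dots$). Moreover, the residue of $\zeta_h(s)$ at $s=1$ equals $-\frac{1}{2}\psi\left(\frac12\right) = \log 2+\frac{\gamma}{2}$; for each positive integer $n$, the residue of $\zeta_h(s)$ at $s=1-2n$ equals $-\frac{B_{2n}(1/2)}{4n}$; and $\zeta_h(s)$ vanishes at the negative even integers.
   Context: For a positive integer $n$, $h_n := \sum_{k=1}^n \frac{1}{2k-1}$. $\psi$ is the digamma function, $\gamma$ is the Euler–Mascheroni constant, and $B_{m}(x)$ is the $m$-th Bernoulli polynomial, defined by $\frac{ze^{xz}}{e^z-1} = \sum_{m=0}^\infty B_m(x)\frac{z^m}{m!}$ for $|z|<2\pi$. *)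

theory Defs
  imports "HOL-Complex_Analysis.Complex_Analysis"
begin

definition odd_harm :: "nat \<Rightarrow> real" where
  "odd_harm n = (\<Sum>k=1..n. 1 / (2 * real k - 1))"

text \<open>
  The sequence of Bernoulli polynomials evaluated at \<open>x\<close> is the sequence of coefficients in the
  expansion of \<open>z * exp (x * z) / (exp z - 1)\<close> on the disc of radius \<open>2 * pi\<close>.
  The point \<open>z = 0\<close>, where this function has a removable singularity, is left out because
  \<open>0 / 0 = 0\<close> in HOL; the lemma \<open>bernoulli_poly_ex1\<close> shows that the coefficients exist and are
  still uniquely determined.
\<close>

definition is_bernoulli_seq :: "complex \<Rightarrow> (nat \<Rightarrow> complex) \<Rightarrow> bool" where
  "is_bernoulli_seq x b \<longleftrightarrow>
     (\<forall>z. z \<noteq> 0 \<longrightarrow> norm z < 2 * pi \<longrightarrow>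
        (\<lambda>m. b m * z ^ m / fact m) sums (z * exp (x * z) / (exp z - 1)))"

definition bernoulli_poly :: "nat \<Rightarrow> complex \<Rightarrow> complex" where
  "bernoulli_poly m x = (THE b. is_bernoulli_seq x b) m"

lemma exp_eq_1_small:
  fixes z :: complex
  assumes "norm z < 2 * pi" "exp z = 1"
  shows "z = 0"
proof -
  from assms(2) obtain n :: int where n: "Re z = 0" "Im z = of_int (2 * n) * pi"
    unfolding exp_eq_1 by blast
  have "\<bar>Im z\<bar> < 2 * pi"
    using abs_Im_le_cmod[of z] assms(1) by linarith
  hence "\<bar>real_of_int n\<bar> * (2 * pi) < 1 * (2 * pi)"
    by (simp add: n(2) abs_mult)
  hence "\<bar>real_of_int n\<bar> < 1"
    by (simp only: mult_less_cancel_right) auto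
  hence "n = 0" by linarith
  with n show ?thesis by (simp add: complex_eq_iff)
qed

lemma bernoulli_seq_exists: "\<exists>b. is_bernoulli_seq x b"
proof -
  define f where "f = (\<lambda>z::complex. z * exp (x * z) / (exp z - 1))"
  define g where "g = (\<lambda>z. if z = 0 then 1 else f z)"
  have "((\<lambda>z::complex. (exp z - 1) / z) \<longlongrightarrow> 1) (at 0)"
    using DERIV_exp[of "0::complex"] by (simp add: DERIV_def)
  hence "((\<lambda>z::complex. exp (x * z) / ((exp z - 1) / z)) \<longlongrightarrow> exp (x * 0) / 1) (at 0)"
    by (intro tendsto_intros) auto
  hence lim: "(f \<longlongrightarrow> 1) (at 0)"
    by (simp add: f_def mult.commute)
  have "f holomorphic_on ball 0 (2 * pi) - {0}"
    unfolding f_def by (intro holomorphic_intros) (auto dest: exp_eq_1_small)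
  hence "g holomorphic_on ball 0 (2 * pi)"
    unfolding g_def by (intro removable_singularity lim) auto
  hence sums: "(\<lambda>n. (deriv ^^ n) g 0 / fact n * (z - 0) ^ n) sums g z" if "norm z < 2 * pi" for z
    by (rule holomorphic_power_series) (use that in auto)
  have "is_bernoulli_seq x (\<lambda>n. (deriv ^^ n) g 0)"
    unfolding is_bernoulli_seq_def
  proof (intro allI impI)
    fix z :: complex
    assume "z \<noteq> 0" "norm z < 2 * pi"
    thus "(\<lambda>m. (deriv ^^ m) g 0 * z ^ m / fact m) sums (z * exp (x * z) / (exp z - 1))"
      using sums[of z] by (simp add: g_def f_def)
  qed
  thus ?thesis by blast
qed

lemma bernoulli_seq_unique:
  assumes "is_bernoulli_seq x b" "is_bernoulli_seq x c"
  shows "b = c"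
proof -
  define f where "f = (\<lambda>z::complex. z * exp (x * z) / (exp z - 1))"
  have sums: "(\<lambda>n. a n / fact n * z ^ n) sums f z"
    if "is_bernoulli_seq x a" "z \<noteq> 0" "norm z < 2 * pi" for a z
    using that by (simp add: is_bernoulli_seq_def f_def)
  have lim: "(f \<longlongrightarrow> a 0) (at 0)" if "is_bernoulli_seq x a" for a
    using powser_limit_0_strong[of "2 * pi" "\<lambda>n. a n / fact n" f] sums[OF that] by simp
  have 0: "b 0 = c 0"
    using LIM_unique[OF lim[OF assms(1)] lim[OF assms(2)]] .
  define g where "g = (\<lambda>z. if z = 0 then b 0 else f z)"
  have expansion: "g has_fps_expansion Abs_fps (\<lambda>n. a n / fact n)"
    if "is_bernoulli_seq x a" "a 0 = b 0" for a
  proof (rule has_fps_expansionI)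
    have "eventually (\<lambda>z::complex. z \<in> ball 0 (2 * pi)) (nhds 0)"
      by (intro eventually_nhds_in_open) auto
    thus "eventually (\<lambda>z. (\<lambda>n. fps_nth (Abs_fps (\<lambda>n. a n / fact n)) n * z ^ n) sums g z) (nhds 0)"
    proof eventually_elim
      case (elim z)
      show ?case
      proof (cases "z = 0")
        case True
        thus ?thesis
          using powser_sums_zero[of "\<lambda>n. a n / fact n"] that(2) by (simp add: g_def)
      next
        case False
        thus ?thesis
          using sums[OF that(1), of z] elim by (simp add: g_def)
      qed
    qed
  qed
  have "Abs_fps (\<lambda>n. b n / fact n) = Abs_fps (\<lambda>n. c n / fact n)"
    by (rule fps_expansion_unique_complex[OF expansion expansion]) (use assms 0 in auto)
  hence "b n / fact n = c n / fact n" for n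
    by (simp add: fps_eq_iff)
  thus ?thesis by (simp add: fun_eq_iff)
qed

lemma bernoulli_poly_ex1: "\<exists>!b. is_bernoulli_seq x b"
  using bernoulli_seq_exists bernoulli_seq_unique by blast

lemma is_bernoulli_seq_bernoulli_poly: "is_bernoulli_seq x (\<lambda>m. bernoulli_poly m x)"
  unfolding bernoulli_poly_def by (rule theI'[OF bernoulli_poly_ex1])

end

theory Submission
  imports Defs
begin

text \<open>
  The continuation comes from the Mellin transform. With \<open>y = exp (- t / 2)\<close> the generating function of
  the coefficients is \<open>G t = (\<Sum>n. h\<^sub>n exp (- n t)) = y / (1 - y\<^sup>2) * artanh y\<close>, and integrating termwise
  gives \<open>\<Gamma>(s) \<zeta>\<^sub>h(s) = \<integral> t powr (s - 1) * G t\<close> over \<open>t > 0\<close> for \<open>Re s > 1\<close>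
  (\<open>dirichlet_series_mellin\<close>, \<open>odd_harm_gen_sums\<close>).

  On \<open>{1..}\<close> the integral is entire in \<open>s\<close> (\<open>mellin_tail_entire\<close>). On \<open>{0<..<1}\<close>, up to the factor \<open>t\<close>, the
  function \<open>G\<close> is \<open>ln t\<close> times a power series plus another power series, with coefficients \<open>- p k\<close>
  and \<open>q k\<close> (\<open>odd_harm_gen_expansion\<close>). Apart from \<open>0\<close>, the closest singularities of \<open>G\<close> are at distance \<open>2\<pi> > 1\<close>,
  so both series converge absolutely at \<open>1\<close>. Termwise integration then turns this part into the
  partial fraction series \<open>\<Sum>k. p k / (s + k - 1)\<^sup>2 + q k / (s + k - 1)\<close> (\<open>mellin_head\<close>), which is meromorphic
  on the whole plane. The continuation is therefore obtained in a single step, without moving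
  through vertical strips.

  Everything else is read off from \<open>Z s = rGamma s * T s\<close>, where \<open>T\<close> is the sum of the two parts.
  Both power series are even, so \<open>T\<close> has poles at most at \<open>1, -1, -3, \<dots>\<close>. Hence \<open>Z\<close> vanishes at the
  negative even integers, where \<open>rGamma\<close> does. At \<open>1 - 2n\<close> with \<open>n \<ge> 1\<close> the simple zero of \<open>rGamma\<close> cancels
  one order of the double pole and leaves the residue \<open>rGamma' (1 - 2n) * p (2n)\<close>, where
  \<open>p k = B\<^sub>k(1/2) / (2 k!)\<close>. That these poles do not disappear is the non-vanishing of \<open>B\<^sub>2\<^sub>n(1/2)\<close>
  (\<open>bernoulli_half_even_nz\<close>). At \<open>1\<close> the double pole survives, with residue \<open>p 0 * rGamma' 1 + q 0\<close>, which is
  \<open>\<gamma> / 2 + ln 2\<close>.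
\<close>

section \<open>Parts of a Mellin integral\<close>

text \<open>
  Dominated convergence for partial sums. Both parts of the Mellin integral below are expanded
  with it, because there a dominating function is easier to find than the integrals of the norms.
\<close>

lemma set_integral_sums_dominated:
  fixes f :: "nat \<Rightarrow> 'a \<Rightarrow> 'b :: {banach, second_countable_topology}" and w :: "'a \<Rightarrow> real"
  assumes f: "\<And>k. set_integrable M A (f k)" and w: "set_integrable M A w"
    and sums: "\<And>x. x \<in> A \<Longrightarrow> (\<lambda>k. f k x) sums g x"
    and bound: "\<And>n x. x \<in> A \<Longrightarrow> norm (\<Sum>k<n. f k x) \<le> w x"
  shows "set_integrable M A g"
    and "(\<lambda>k. LINT x:A|M. f k x) sums (LINT x:A|M. g x)"
proof -
  define F where "F = (\<lambda>n x. indicator A x *\<^sub>R (\<Sum>k<n. f k x))"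
  have F_eq: "F n = (\<lambda>x. \<Sum>k<n. indicator A x *\<^sub>R f k x)" for n
    by (simp add: F_def scaleR_sum_right)
  have F: "integrable M (F n)" for n
    unfolding F_eq using f by (intro Bochner_Integration.integrable_sum) (simp add: set_integrable_def)
  have lim: "(\<lambda>n. F n x) \<longlonglongrightarrow> indicator A x *\<^sub>R g x" for x
    using sums[of x] by (cases "x \<in> A") (auto simp: F_def sums_def)
  have meas: "(\<lambda>x. indicator A x *\<^sub>R g x) \<in> borel_measurable M"
    by (rule borel_measurable_LIMSEQ_metric[of F]) (use F lim in auto)
  have w': "integrable M (\<lambda>x. indicator A x *\<^sub>R w x)"
    using w by (simp add: set_integrable_def)
  have le: "norm (F n x) \<le> indicator A x *\<^sub>R w x" for n x
    using bound[of x n] by (cases "x \<in> A") (auto simp: F_def)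
  show "set_integrable M A g"
    unfolding set_integrable_def
    by (rule integrable_dominated_convergence[OF meas _ w', where s = F]) (use F lim le in auto)
  have "(\<lambda>n. integral\<^sup>L M (F n)) \<longlonglongrightarrow> (LINT x:A|M. g x)"
    unfolding set_lebesgue_integral_def
    by (rule integral_dominated_convergence[OF meas _ w']) (use F lim le in auto)
  moreover have "integral\<^sup>L M (F n) = (\<Sum>k<n. LINT x:A|M. f k x)" for n
    unfolding F_eq set_lebesgue_integral_def using f
    by (intro Bochner_Integration.integral_sum) (simp add: set_integrable_def)
  ultimately show "(\<lambda>k. LINT x:A|M. f k x) sums (LINT x:A|M. g x)"
    by (simp add: sums_def)
qed

lemma norm_exp_of_real: "norm (exp (z * of_real x)) = exp (Re z * x)"
  by (simp add: norm_exp_eq_Re)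

lemma set_borel_measurable_continuous_lborel:
  fixes f :: "real \<Rightarrow> 'b :: {banach, second_countable_topology}"
  assumes "A \<in> sets borel" "continuous_on A f"
  shows "set_borel_measurable lborel A f"
  using borel_measurable_continuous_on_indicator[OF assms] by (simp add: set_borel_measurable_def)

text \<open>
  Powers \<open>t powr (a - 1)\<close> are written \<open>exp ((a - 1) * ln t)\<close> throughout. For \<open>t > 0\<close> the two agree, and
  the exponential form keeps the dependence on the exponent visible.
\<close>

lemma real_power_moment:
  fixes a :: real
  assumes a: "a > 0"
  shows "set_integrable lborel {0<..<1} (\<lambda>t. exp ((a - 1) * ln t))"
    and "set_integrable lborel {0<..<1} (\<lambda>t. exp ((a - 1) * ln t) * (- ln t))"
proof -
  have *: "einterval (ereal 0) (ereal 1) = {0<..<1}" by (auto simp: einterval_def)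
  have "((\<lambda>t. exp (a * ln t) / a) \<longlongrightarrow> 0) (at_right 0)" using a by real_asymp
  moreover have "((\<lambda>t. exp (a * ln t) / a) \<longlongrightarrow> 1 / a) (at_left 1)" using a
    by (auto intro!: tendsto_eq_intros)
  ultimately have "set_integrable lborel (einterval (ereal 0) (ereal 1)) (\<lambda>t. exp ((a - 1) * ln t))"
    using a by (intro interval_integral_FTC_nonneg(1)[where F = "\<lambda>t. exp (a * ln t) / a" and A = 0 and B = "1/a"])
       (auto intro!: derivative_eq_intros continuous_intros simp: ereal_tendsto_simps field_simps exp_diff)
  thus "set_integrable lborel {0<..<1} (\<lambda>t. exp ((a - 1) * ln t))"
    by (simp only: *)
  have "((\<lambda>t. exp (a * ln t) * (1 / a^2 - ln t / a)) \<longlongrightarrow> 0) (at_right 0)" using a by real_asymp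
  moreover have "((\<lambda>t. exp (a * ln t) * (1 / a^2 - ln t / a)) \<longlongrightarrow> 1 / a^2) (at_left 1)" using a
    by (auto intro!: tendsto_eq_intros)
  ultimately have "set_integrable lborel (einterval (ereal 0) (ereal 1)) (\<lambda>t. exp ((a - 1) * ln t) * (- ln t))"
    using a by (intro interval_integral_FTC_nonneg(1)[where F = "\<lambda>t. exp (a * ln t) * (1 / a^2 - ln t / a)" and A = 0 and B = "1/a^2"])
       (auto intro!: derivative_eq_intros continuous_intros simp: ereal_tendsto_simps field_simps exp_diff power2_eq_square mult_nonpos_nonneg)
  thus "set_integrable lborel {0<..<1} (\<lambda>t. exp ((a - 1) * ln t) * (- ln t))"
    by (simp only: *)
qed

lemma complex_power_moment:
  fixes a :: complex
  assumes a: "Re a > 0"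
  shows "set_integrable lborel {0<..<1} (\<lambda>t. exp ((a - 1) * of_real (ln t)))"
    and "(LINT t:{0<..<1}|lborel. exp ((a - 1) * of_real (ln t))) = 1 / a"
    and "set_integrable lborel {0<..<1} (\<lambda>t. exp ((a - 1) * of_real (ln t)) * of_real (- ln t))"
    and "(LINT t:{0<..<1}|lborel. exp ((a - 1) * of_real (ln t)) * of_real (- ln t)) = 1 / a\<^sup>2"
proof -
  have *: "einterval (ereal 0) (ereal 1) = {0<..<1}" by (auto simp: einterval_def)
  have a0: "a \<noteq> 0" using a by auto
  have cont: "continuous_on {0<..<1} (\<lambda>t. exp ((a - 1) * of_real (ln t)))"
             "continuous_on {0<..<1} (\<lambda>t. exp ((a - 1) * of_real (ln t)) * of_real (- ln t))"
    by (auto intro!: continuous_intros)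
  show int1: "set_integrable lborel {0<..<1} (\<lambda>t. exp ((a - 1) * of_real (ln t)))"
    by (rule set_integrable_bound[OF real_power_moment(1)[OF a]])
       (use cont in \<open>auto intro!: set_borel_measurable_continuous_lborel simp: norm_exp_of_real\<close>)
  show int2: "set_integrable lborel {0<..<1} (\<lambda>t. exp ((a - 1) * of_real (ln t)) * of_real (- ln t))"
    by (rule set_integrable_bound[OF real_power_moment(2)[OF a]])
       (use cont in \<open>auto intro!: set_borel_measurable_continuous_lborel simp: norm_exp_of_real norm_mult\<close>)
  have ln_deriv: "((\<lambda>t. complex_of_real (ln t)) has_vector_derivative of_real (1 / t)) (at t)" if "t > 0" for t
    using that by (intro has_vector_derivative_of_real)
      (auto intro!: derivative_eq_intros simp flip: has_real_derivative_iff_has_vector_derivative)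
  have exp_t: "exp ((a - 1) * of_real (ln t)) = exp (a * of_real (ln t)) / of_real t" if "t > 0" for t
    using that by (simp add: ring_distribs exp_diff exp_of_real)
  have deriv1: "((\<lambda>u. exp (a * u) / a) has_field_derivative exp (a * of_real (ln t))) (at (of_real (ln t)))" for t
    using a0 by (auto intro!: derivative_eq_intros)
  have deriv2: "((\<lambda>u. exp (a * u) / a / a - exp (a * u) * u / a) has_field_derivative
                  - exp (a * of_real (ln t)) * of_real (ln t)) (at (of_real (ln t)))" for t
    using a0 by (auto intro!: derivative_eq_intros simp: field_simps)
  have "((\<lambda>t. exp (Re a * ln t)) \<longlongrightarrow> 0) (at_right 0)" using a by real_asymp
  hence "((\<lambda>t. exp (a * of_real (ln t))) \<longlongrightarrow> 0) (at_right 0)"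
    by (subst tendsto_norm_zero_iff [symmetric]) (simp add: norm_exp_of_real)
  hence lim0: "((\<lambda>t. exp (a * of_real (ln t)) / a) \<longlongrightarrow> 0) (at_right 0)"
    by (auto intro: tendsto_divide_zero)
  have "((\<lambda>t. exp (Re a * ln t) * \<bar>ln t\<bar>) \<longlongrightarrow> 0) (at_right 0)" using a by real_asymp
  hence "((\<lambda>t. exp (a * of_real (ln t)) * of_real (ln t)) \<longlongrightarrow> 0) (at_right 0)"
    by (subst tendsto_norm_zero_iff [symmetric]) (simp add: norm_exp_of_real norm_mult)
  hence lim0': "((\<lambda>t. exp (a * of_real (ln t)) / a / a - exp (a * of_real (ln t)) * of_real (ln t) / a) \<longlongrightarrow> 0 - 0) (at_right 0)"
    by (rule tendsto_diff[OF tendsto_divide_zero[OF lim0] tendsto_divide_zero])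
  have "(LBINT t=ereal 0..ereal 1. exp ((a - 1) * of_real (ln t))) = 1 / a - 0"
  proof (rule interval_integral_FTC_integrable[where F = "\<lambda>t. exp (a * of_real (ln t)) / a"])
    show "(((\<lambda>t. exp (a * of_real (ln t)) / a) \<circ> real_of_ereal) \<longlongrightarrow> 1 / a) (at_left (ereal 1))"
      unfolding ereal_tendsto_simps by (auto intro!: tendsto_eq_intros simp: a0)
    fix t :: real assume "ereal 0 < ereal t" "ereal t < ereal 1"
    thus "((\<lambda>t. exp (a * of_real (ln t)) / a) has_vector_derivative exp ((a - 1) * of_real (ln t))) (at t)"
      using field_vector_diff_chain_at[OF ln_deriv, of t "\<lambda>u. exp (a * u) / a" "exp (a * of_real (ln t))"]
            deriv1[of t] by (simp add: o_def exp_t)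
  qed (use lim0 int1 in \<open>auto simp: ereal_tendsto_simps * intro!: continuous_intros\<close>)
  thus "(LINT t:{0<..<1}|lborel. exp ((a - 1) * of_real (ln t))) = 1 / a"
    by (simp add: interval_lebesgue_integral_def *)
  have "(LBINT t=ereal 0..ereal 1. exp ((a - 1) * of_real (ln t)) * of_real (- ln t)) = 1 / a^2 - 0"
  proof (rule interval_integral_FTC_integrable[where F = "\<lambda>t. exp (a * of_real (ln t)) / a / a - exp (a * of_real (ln t)) * of_real (ln t) / a"])
    show "(((\<lambda>t. exp (a * of_real (ln t)) / a / a - exp (a * of_real (ln t)) * of_real (ln t) / a) \<circ> real_of_ereal) \<longlongrightarrow> 1 / a^2) (at_left (ereal 1))"
      unfolding ereal_tendsto_simps by (auto intro!: tendsto_eq_intros simp: a0 power2_eq_square)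
    fix t :: real assume "ereal 0 < ereal t" "ereal t < ereal 1"
    thus "((\<lambda>t. exp (a * of_real (ln t)) / a / a - exp (a * of_real (ln t)) * of_real (ln t) / a) has_vector_derivative
            exp ((a - 1) * of_real (ln t)) * of_real (- ln t)) (at t)"
      using field_vector_diff_chain_at[OF ln_deriv, of t "\<lambda>u. exp (a * u) / a / a - exp (a * u) * u / a" "- exp (a * of_real (ln t)) * of_real (ln t)"]
            deriv2[of t] by (simp add: o_def exp_t)
  qed (use lim0' int2 in \<open>auto simp: ereal_tendsto_simps * intro!: continuous_intros\<close>)
  thus "(LINT t:{0<..<1}|lborel. exp ((a - 1) * of_real (ln t)) * of_real (- ln t)) = 1 / a\<^sup>2"
    by (simp add: interval_lebesgue_integral_def *)
qed


text \<open>
  The function \<open>t powr (s - 1) * t powr (k - 1)\<close> has integral \<open>1 / (s + k - 1)\<close> over \<open>{0<..<1}\<close>, and an additional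
  factor \<open>- ln t\<close> squares this. Since \<open>t ^ k \<le> 1\<close>, all partial sums are dominated by a
  combination of \<open>t powr (Re s - 2)\<close> and \<open>- ln t * t powr (Re s - 2)\<close>, which is integrable for \<open>Re s > 1\<close>.
\<close>

lemma mellin_head:
  fixes p q :: "nat \<Rightarrow> complex" and g :: "real \<Rightarrow> complex"
  assumes p: "summable (\<lambda>k. norm (p k))" and q: "summable (\<lambda>k. norm (q k))"
    and g: "\<And>t. 0 < t \<Longrightarrow> t < 1 \<Longrightarrow>
              (\<lambda>k. (q k - p k * of_real (ln t)) * of_real t ^ k) sums (of_real t * g t)"
    and s: "Re s > 1"
  shows "(\<lambda>k. p k / (s + of_nat k - 1)\<^sup>2 + q k / (s + of_nat k - 1)) sums
           (LINT t:{0<..<1}|lborel. exp ((s - 1) * of_real (ln t)) * g t)"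
proof -
  define f where "f = (\<lambda>k t. exp ((s - 2) * of_real (ln t)) * ((q k - p k * of_real (ln t)) * of_real t ^ k))"
  define w where "w = (\<lambda>t. (\<Sum>k. norm (q k)) * exp ((Re s - 1 - 1) * ln t) +
                     (\<Sum>k. norm (p k)) * (exp ((Re s - 1 - 1) * ln t) * (- ln t)))"
  define F where "F = (\<lambda>k t. q k * exp ((s + of_nat k - 1 - 1) * of_real (ln t)) +
       p k * (exp ((s + of_nat k - 1 - 1) * of_real (ln t)) * of_real (- ln t)))"
  have f_eq: "f k t = F k t" if "t \<in> {0<..<1}" for k t
  proof -
    have "complex_of_real t ^ k = exp (of_nat k * of_real (ln t))"
      using that by (simp add: exp_of_nat_mult exp_of_real)
    thus ?thesis
      by (simp add: f_def F_def ring_distribs exp_add exp_diff field_simps)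
  qed
  have Re: "Re (s + of_nat k - 1) > 0" for k using s by simp
  note pm = complex_power_moment[OF Re]
  have F: "set_integrable lborel {0<..<1} (F k)" for k
    unfolding F_def
    by (intro set_integral_add set_integrable_mult_right pm)
  have "set_integrable lborel {0<..<1} (f k) \<longleftrightarrow> set_integrable lborel {0<..<1} (F k)" for k
    by (rule set_integrable_cong) (use f_eq in auto)
  with F have f: "set_integrable lborel {0<..<1} (f k)" for k by blast
  have w: "set_integrable lborel {0<..<1} w"
    unfolding w_def using s
    by (intro set_integral_add set_integrable_mult_right real_power_moment) auto
  have bound: "norm (\<Sum>k<n. f k t) \<le> w t" if t: "t \<in> {0<..<1}" for n t
  proof -
    have "norm (\<Sum>k<n. f k t) \<le> (\<Sum>k<n. exp ((Re s - 2) * ln t) * (norm (q k) + norm (p k) * (- ln t)))"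
    proof (rule sum_norm_le)
      fix k
      have "norm (f k t) = exp ((Re s - 2) * ln t) * (norm (q k - p k * of_real (ln t)) * t ^ k)"
        using t by (simp add: f_def norm_mult norm_power norm_exp_of_real)
      also have "norm (q k - p k * of_real (ln t)) * t ^ k \<le> norm (q k - p k * of_real (ln t)) * 1"
        using t by (intro mult_left_mono) (auto intro: power_le_one)
      also have "norm (q k - p k * of_real (ln t)) \<le> norm (q k) + norm (p k) * (- ln t)"
        using t norm_triangle_ineq4[of "q k" "p k * of_real (ln t)"] by (simp add: norm_mult)
      finally show "norm (f k t) \<le> exp ((Re s - 2) * ln t) * (norm (q k) + norm (p k) * (- ln t))"
        by simp
    qed
    also have "\<dots> = exp ((Re s - 2) * ln t) * ((\<Sum>k<n. norm (q k)) + (\<Sum>k<n. norm (p k)) * (- ln t))"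
      by (simp add: sum.distrib sum_subtractf ring_distribs flip: sum_distrib_left sum_distrib_right)
    also have "\<dots> \<le> exp ((Re s - 2) * ln t) * ((\<Sum>k. norm (q k)) + (\<Sum>k. norm (p k)) * (- ln t))"
      using t p q by (intro mult_left_mono add_mono mult_right_mono sum_le_suminf) auto
    also have "\<dots> = w t"
      by (simp add: w_def ring_distribs)
    finally show ?thesis .
  qed
  have sums: "(\<lambda>k. f k t) sums (exp ((s - 1) * of_real (ln t)) * g t)" if t: "t \<in> {0<..<1}" for t
  proof -
    have "(\<lambda>k. f k t) sums (exp ((s - 2) * of_real (ln t)) * (of_real t * g t))"
      unfolding f_def using t by (intro sums_mult g) auto
    moreover have "exp ((s - 1) * of_real (ln t)) = exp ((s - 2) * of_real (ln t)) * of_real t"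
      using t by (simp add: left_diff_distrib exp_diff exp_of_real exp_double power2_eq_square)
    ultimately show ?thesis by (simp add: mult_ac)
  qed
  have "(LINT t:{0<..<1}|lborel. f k t) = p k / (s + of_nat k - 1)\<^sup>2 + q k / (s + of_nat k - 1)" for k
  proof -
    have "(LINT t:{0<..<1}|lborel. f k t) = (LINT t:{0<..<1}|lborel. F k t)"
      by (rule set_lebesgue_integral_cong) (use f_eq in auto)
    also have "\<dots> = p k / (s + of_nat k - 1)\<^sup>2 + q k / (s + of_nat k - 1)"
      unfolding F_def using pm[of k]
      by (subst set_integral_add) (auto intro!: set_integrable_mult_right simp del: of_real_minus)
    finally show ?thesis .
  qed
  with set_integral_sums_dominated(2)[OF f w sums bound] show ?thesis by simp
qed

text \<open>
  For \<open>t \<ge> 1\<close> the integrand expands into powers of \<open>s\<close>, and the partial sums of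
  \<open>exp (s * ln t)\<close> are dominated by \<open>t powr norm s\<close>. Integrating termwise shows that the integral is the sum
  of an everywhere convergent power series in \<open>s\<close>.
\<close>

lemma mellin_tail_entire:
  fixes g :: "real \<Rightarrow> real"
  assumes g: "\<And>\<sigma>::real. \<sigma> > 1 \<Longrightarrow> set_integrable lborel {1..} (\<lambda>t. exp ((\<sigma> - 1) * ln t) * g t)"
  shows "(\<lambda>s. LINT t:{1..}|lborel. exp ((s - 1) * of_real (ln t)) * of_real (g t)) holomorphic_on UNIV"
proof -
  define c where "c = (\<lambda>k. LINT t:{1..}|lborel. complex_of_real (ln t) ^ k / fact k * of_real (exp (- ln t) * g t))"
  have sums: "(\<lambda>k. c k * s ^ k) sums (LINT t:{1..}|lborel. exp ((s - 1) * of_real (ln t)) * of_real (g t))"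
    for s :: complex
  proof -
    define f where "f = (\<lambda>k t. (s * of_real (ln t)) ^ k / fact k * complex_of_real (exp (- ln t) * g t))"
    \<comment> \<open>the summand \<open>2\<close> makes \<open>R > 1\<close>, so that the assumption applies to the dominating function\<close>
    define R where "R = norm s + 2"
    define w where "w = (\<lambda>t. \<bar>exp ((R - 1) * ln t) * g t\<bar>)"
    have "R > 1" by (simp add: R_def add_pos_nonneg)
    have w: "set_integrable lborel {1..} w"
      unfolding w_def using g[OF \<open>R > 1\<close>] by (rule set_integrable_abs)
    have exp_le: "(\<Sum>k<n. (norm s * ln t) ^ k / fact k) \<le> exp (norm s * ln t)" if "t \<ge> 1" for n t
    proof -
      have "(\<lambda>k. (norm s * ln t) ^ k / fact k) sums exp (norm s * ln t)"
        using exp_converges[of "norm s * ln t"] by (simp add: divide_inverse mult.commute scaleR_conv_of_real)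
      thus ?thesis using that
        using sum_le_suminf[of "\<lambda>k. (norm s * ln t) ^ k / fact k" "{..<n}"] by (auto simp: sums_iff)
    qed
    have sum_bound: "(\<Sum>k<n. norm (f k t)) \<le> w t" if t: "t \<in> {1..}" for n t
    proof -
      have "(\<Sum>k<n. norm (f k t)) = (\<Sum>k<n. (norm s * ln t) ^ k / fact k) * (exp (- ln t) * \<bar>g t\<bar>)"
        using t by (simp add: f_def norm_mult norm_power norm_divide abs_mult sum_distrib_right)
      also have "\<dots> \<le> exp (norm s * ln t) * (exp (- ln t) * \<bar>g t\<bar>)"
        using exp_le[of t n] t by (intro mult_right_mono) auto
      also have "\<dots> \<le> exp ((R - 1) * ln t) * \<bar>g t\<bar>"
        using t by (simp add: R_def mult_right_mono ring_distribs flip: mult.assoc exp_add)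
      finally show ?thesis by (simp add: w_def abs_mult)
    qed
    have bound: "norm (\<Sum>k<n. f k t) \<le> w t" if "t \<in> {1..}" for n t
      using sum_bound[OF that, of n] norm_sum[of "\<lambda>k. f k t" "{..<n}"] by linarith
    \<comment> \<open>measurability of \<open>g\<close> is recovered from that of its product with a positive measurable function\<close>
    have "(\<lambda>t. exp (- ((R - 1) * ln t)) * (indicator {1..} t *\<^sub>R (exp ((R - 1) * ln t) * g t))) \<in> borel_measurable lborel"
      using g[OF \<open>R > 1\<close>] by (intro borel_measurable_times) (auto simp: set_integrable_def)
    also have "(\<lambda>t. exp (- ((R - 1) * ln t)) * (indicator {1..} t *\<^sub>R (exp ((R - 1) * ln t) * g t))) =
               (\<lambda>t. indicator {1..} t * g t)"
      by (simp add: fun_eq_iff exp_minus)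
    finally have g_meas: "(\<lambda>t. indicator {1..} t * g t) \<in> borel_measurable lborel" .
    have "(\<lambda>t. (s * of_real (ln t)) ^ k / fact k * complex_of_real (exp (- ln t) * (indicator {1..} t * g t)))
            \<in> borel_measurable lborel" for k
      using g_meas by measurable
    also have "(\<lambda>t. (s * of_real (ln t)) ^ k / fact k * complex_of_real (exp (- ln t) * (indicator {1..} t * g t))) =
               (\<lambda>t. indicator {1..} t *\<^sub>R f k t)" for k
      by (auto simp: fun_eq_iff f_def indicator_def)
    finally have f_meas: "set_borel_measurable lborel {1..} (f k)" for k
      by (simp add: set_borel_measurable_def)
    have le_w: "norm (f k t) \<le> w t" if "t \<in> {1..}" for k t
      using sum_bound[OF that, of "Suc k"] member_le_sum[of k "{..<Suc k}" "\<lambda>k. norm (f k t)"] by auto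
    have f: "set_integrable lborel {1..} (f k)" for k
      by (rule set_integrable_bound[OF w f_meas]) (use le_w in \<open>auto simp: w_def\<close>)
    have sums: "(\<lambda>k. f k t) sums (exp ((s - 1) * of_real (ln t)) * of_real (g t))" for t
    proof -
      have "(\<lambda>k. (s * of_real (ln t)) ^ k / fact k) sums exp (s * of_real (ln t))"
        using exp_converges[of "s * of_real (ln t)"]
        by (simp add: divide_inverse mult.commute scaleR_conv_of_real)
      from sums_mult2[OF this, of "of_real (exp (- ln t) * g t)"] show ?thesis
        by (simp add: f_def ring_distribs exp_diff exp_minus exp_of_real field_simps)
    qed
    have "(LINT t:{1..}|lborel. f k t) = c k * s ^ k" for k
      unfolding c_def f_def by (subst set_integral_mult_left [symmetric]) (simp add: power_mult_distrib mult_ac)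
    with set_integral_sums_dominated(2)[OF f w sums bound] show ?thesis by simp
  qed
  have "(\<lambda>s. LINT t:{1..}|lborel. exp ((s - 1) * of_real (ln t)) * of_real (g t)) holomorphic_on ball 0 r" for r
    by (rule power_series_holomorphic[where a = c]) (use sums in auto)
  hence "(\<lambda>s. LINT t:{1..}|lborel. exp ((s - 1) * of_real (ln t)) * of_real (g t)) holomorphic_on (\<Union>r. ball 0 r)"
    by (intro holomorphic_on_UN_open) auto
  moreover have "(\<Union>r. ball 0 r) = (UNIV :: complex set)"
    using gt_ex by auto
  ultimately show ?thesis by simp
qed

section \<open>Mellin transforms of Dirichlet series\<close>

lemma Gamma_integral_scaled:
  fixes s :: complex and c :: real
  assumes s: "Re s > 0" and c: "c > 0"
  shows "set_integrable lborel {0<..} (\<lambda>t. exp ((s - 1) * of_real (ln t)) * of_real (exp (- c * t)))"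
    and "(LINT t:{0<..}|lborel. exp ((s - 1) * of_real (ln t)) * of_real (exp (- c * t))) =
           Gamma s * exp (- s * of_real (ln c))"
proof -
  define f where "f = (\<lambda>c t. indicator {0<..} t *\<^sub>R (exp ((s - 1) * of_real (ln t)) * complex_of_real (exp (- c * t))))"
  have f1_eq: "f 1 = (\<lambda>t. indicator {0<..} t *\<^sub>R (of_real t powr (s - 1) / of_real (exp t)))"
    by (auto simp: f_def fun_eq_iff indicator_def powr_def Ln_of_real exp_minus field_simps)
  have meas: "f 1 \<in> borel_measurable lborel"
    using set_borel_measurable_continuous_lborel[of "{0<..}"
            "\<lambda>t. exp ((s - 1) * of_real (ln t)) * complex_of_real (exp (- 1 * t))"]
    by (auto simp: f_def set_borel_measurable_def intro!: continuous_intros)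
  note ai = absolutely_integrable_Gamma_integral'[OF s]
  have "integrable lebesgue (f 1)"
    unfolding f1_eq using ai by (simp add: set_integrable_def)
  hence int: "integrable lborel (f 1)"
    using integrable_completion[OF meas] by simp
  have "integral\<^sup>L lborel (f 1) = integral\<^sup>L lebesgue (f 1)"
    using integral_completion[OF meas] by simp
  also have "\<dots> = Gamma s"
    using has_integral_unique[OF has_integral_set_lebesgue[OF ai] Gamma_integral_complex'[OF s]]
    by (simp add: f1_eq set_lebesgue_integral_def)
  finally have val: "integral\<^sup>L lborel (f 1) = Gamma s" .
  define C where "C = exp (- (s - 1) * complex_of_real (ln c))"
  have fc: "f c = (\<lambda>t. C * f 1 (0 + c * t))"
  proof
    fix t :: real
    have "ln (c * t) = ln c + ln t" if "t > 0" using that c by (simp add: ln_mult)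
    thus "f c t = C * f 1 (0 + c * t)"
      using c by (auto simp: f_def C_def indicator_def zero_less_mult_iff ring_distribs exp_add exp_diff exp_minus field_simps)
  qed
  have "integrable lborel (f c)"
    unfolding fc using lborel_integrable_real_affine[OF int, of c 0] c by (intro integrable_mult_right) auto
  thus "set_integrable lborel {0<..} (\<lambda>t. exp ((s - 1) * of_real (ln t)) * of_real (exp (- c * t)))"
    by (simp add: f_def set_integrable_def)
  have "integral\<^sup>L lborel (f 1) = c *\<^sub>R (LINT t|lborel. f 1 (0 + c * t))"
    using c lborel_integral_real_affine[of c "f 1" 0] by simp
  hence "(LINT t|lborel. f 1 (0 + c * t)) = Gamma s / c"
    using c val by (simp add: scaleR_conv_of_real field_simps)
  hence "integral\<^sup>L lborel (f c) = C * (Gamma s / c)"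
    unfolding fc by simp
  also have "complex_of_real c = exp (of_real (ln c))" using c by (simp add: exp_of_real)
  also have "C * (Gamma s / exp (of_real (ln c))) = Gamma s * exp (- s * of_real (ln c))"
    by (simp add: C_def ring_distribs exp_diff exp_minus field_simps)
  finally show "(LINT t:{0<..}|lborel. exp ((s - 1) * of_real (ln t)) * of_real (exp (- c * t))) =
           Gamma s * exp (- s * of_real (ln c))"
    by (simp add: f_def set_lebesgue_integral_def)
qed

text \<open>
  All coefficients are nonnegative, so the integrals of the norms add up to the Dirichlet series at
  \<open>Re s\<close> times \<open>Gamma (Re s)\<close>. Its convergence permits exchanging sum and integral and also yields
  the integrability of the Mellin integrand.
\<close>

lemma dirichlet_series_mellin:
  fixes a :: "nat \<Rightarrow> real" and g :: "real \<Rightarrow> real" and s :: complex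
  assumes a: "\<And>n. a n \<ge> 0" and s: "Re s > 0"
    and conv: "summable (\<lambda>n. a n * exp (- Re s * ln (real (Suc n))))"
    and g: "\<And>t. t > 0 \<Longrightarrow> (\<lambda>n. a n * exp (- real (Suc n) * t)) sums g t"
  shows "set_integrable lborel {0<..} (\<lambda>t. exp ((s - 1) * of_real (ln t)) * of_real (g t))"
    and "(\<lambda>n. of_real (a n) * exp (- s * of_real (ln (real (Suc n)))) * Gamma s) sums
           (LINT t:{0<..}|lborel. exp ((s - 1) * of_real (ln t)) * of_real (g t))"
proof -
  define f where "f = (\<lambda>n t. indicator {0<..} t *\<^sub>R
    (exp ((s - 1) * of_real (ln t)) * of_real (a n * exp (- real (Suc n) * t))))"
  note G = Gamma_integral_scaled[of _ "real (Suc _)"]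
  have f_alt: "f n = (\<lambda>t. of_real (a n) * (indicator {0<..} t *\<^sub>R
    (exp ((s - 1) * of_real (ln t)) * of_real (exp (- real (Suc n) * t)))))" for n
    by (simp add: f_def fun_eq_iff mult_ac)
  have int: "integrable lborel (f n)" for n
    unfolding f_alt using G(1)[OF s] by (intro integrable_mult_right) (auto simp: set_integrable_def)
  have val: "integral\<^sup>L lborel (f n) = of_real (a n) * exp (- s * of_real (ln (real (Suc n)))) * Gamma s" for n
    unfolding f_alt Bochner_Integration.integral_mult_right_zero G(2)[OF s of_nat_0_less_iff[THEN iffD2, OF zero_less_Suc], unfolded set_lebesgue_integral_def]
    by (simp only: mult_ac)
  have sums: "(\<lambda>n. f n t) sums (indicator {0<..} t *\<^sub>R (exp ((s - 1) * of_real (ln t)) * of_real (g t)))" for t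
  proof (cases "t > 0")
    case True
    thus ?thesis
      unfolding f_def using sums_mult[OF sums_of_real[OF g[OF True]], of "exp ((s - 1) * of_real (ln t))"] by simp
  qed (auto simp: f_def)
  have norm_sums: "summable (\<lambda>n. norm (f n t))" for t
  proof (cases "t > 0")
    case True
    have "summable (\<lambda>n. exp ((Re s - 1) * ln t) * (a n * exp (- real (Suc n) * t)))"
      using g[OF True] by (intro summable_mult) (auto simp: sums_iff)
    thus ?thesis
      using True a by (simp add: f_def norm_mult norm_exp_of_real abs_mult del: of_nat_Suc)
  qed (auto simp: f_def)
  have norm_int: "(LINT t|lborel. norm (f n t)) = a n * exp (- Re s * ln (real (Suc n))) * Gamma (Re s)" for n
  proof -
    define S where "S = complex_of_real (Re s)"
    have S: "Re S > 0" using s by (simp add: S_def)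
    have "complex_of_real (LINT t|lborel. norm (f n t)) = (LINT t|lborel. complex_of_real (norm (f n t)))"
      by simp
    also have "(\<lambda>t. complex_of_real (norm (f n t))) = (\<lambda>t. of_real (a n) * (indicator {0<..} t *\<^sub>R
        (exp ((S - 1) * of_real (ln t)) * of_real (exp (- real (Suc n) * t)))))"
      using a by (auto simp: f_def fun_eq_iff norm_mult norm_exp_of_real abs_mult indicator_def S_def
            simp del: of_nat_Suc simp flip: exp_of_real)
    also have "(LINT t|lborel. \<dots> t) = of_real (a n) * exp (- S * of_real (ln (real (Suc n)))) * Gamma S"
      unfolding Bochner_Integration.integral_mult_right_zero
        G(2)[OF S of_nat_0_less_iff[THEN iffD2, OF zero_less_Suc], unfolded set_lebesgue_integral_def]
      by (simp only: mult_ac)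
    also have "\<dots> = of_real (a n * exp (- Re s * ln (real (Suc n))) * Gamma (Re s))"
      by (simp add: S_def Gamma_complex_of_real flip: exp_of_real)
    finally show ?thesis by (simp only: of_real_eq_iff)
  qed
  have norm_summable: "summable (\<lambda>n. LINT t|lborel. norm (f n t))"
    unfolding norm_int using conv by (rule summable_mult2)
  have eq: "(\<Sum>n. f n t) = indicator {0<..} t *\<^sub>R (exp ((s - 1) * of_real (ln t)) * of_real (g t))" for t
    using sums[of t] by (simp add: sums_iff)
  show "set_integrable lborel {0<..} (\<lambda>t. exp ((s - 1) * of_real (ln t)) * of_real (g t))"
    using integrable_suminf[OF int _ norm_summable] norm_sums by (simp add: eq set_integrable_def)
  show "(\<lambda>n. of_real (a n) * exp (- s * of_real (ln (real (Suc n)))) * Gamma s) sums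
           (LINT t:{0<..}|lborel. exp ((s - 1) * of_real (ln t)) * of_real (g t))"
    using sums_integral[OF int _ norm_summable] norm_sums by (simp add: eq val set_lebesgue_integral_def)
qed

section \<open>Partial fraction series\<close>

text \<open>
  Around a point at distance \<open>r\<close> from all poles, the terms are bounded on the ball of radius \<open>r / 2\<close>
  by \<open>norm (p k) / (r / 2)\<^sup>2 + norm (q k) / (r / 2)\<close>, independently of the location of the poles. Only
  indices with a non-zero coefficient contribute a pole; the other terms are \<open>0\<close> even at
  \<open>1 - of_nat k\<close>, as \<open>0 / 0 = 0\<close>.
\<close>

lemma partial_fraction_series_holomorphic:
  fixes p q :: "nat \<Rightarrow> complex"
  assumes p: "summable (\<lambda>k. norm (p k))" and q: "summable (\<lambda>k. norm (q k))"
  defines "A \<equiv> - {1 - of_nat k | k. p k \<noteq> 0 \<or> q k \<noteq> 0}"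
  shows "\<exists>S. S holomorphic_on A \<and>
           (\<forall>s\<in>A. (\<lambda>k. p k / (s + of_nat k - 1)\<^sup>2 + q k / (s + of_nat k - 1)) sums S s)"
proof -
  have "{1 - of_nat k | k. p k \<noteq> 0 \<or> q k \<noteq> 0} \<subseteq> (\<int> :: complex set)" by auto
  hence A: "open A"
    unfolding A_def using closed_subset_Ints by (blast intro: open_Compl)
  define f where "f = (\<lambda>k s. p k / (s + of_nat k - 1)\<^sup>2 + q k / (s + of_nat k - 1))"
  have nz: "s + of_nat k - 1 \<noteq> 0" if "s \<in> A" "p k \<noteq> 0 \<or> q k \<noteq> 0" for s k
  proof
    assume "s + of_nat k - 1 = 0"
    hence "s = 1 - of_nat k" by (simp add: algebra_simps)
    with that show False by (auto simp: A_def)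
  qed
  define f' where "f' = (\<lambda>k s. deriv (f k) s)"
  have hol: "f k holomorphic_on A" for k
    unfolding f_def using nz by (cases "p k \<noteq> 0 \<or> q k \<noteq> 0") (auto intro!: holomorphic_intros)
  have "\<exists>g g'. \<forall>s\<in>A. (\<lambda>k. f k s) sums g s \<and> (\<lambda>k. f' k s) sums g' s \<and> (g has_field_derivative g' s) (at s)"
  proof (rule series_and_derivative_comparison_local[OF A])
    show "(f k has_field_derivative f' k s) (at s)" if "s \<in> A" for k s
      unfolding f'_def using holomorphic_derivI[OF hol A that] .
    fix s assume "s \<in> A"
    then obtain r where r: "r > 0" "ball s r \<subseteq> A"
      using A openE by blast
    define h where "h = (\<lambda>k. norm (p k) / (r/2)^2 + norm (q k) / (r/2))"
    have "norm (f k y) \<le> h k" if y: "y \<in> ball s (r/2)" for k y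
    proof (cases "p k \<noteq> 0 \<or> q k \<noteq> 0")
      case True
      have "1 - of_nat k \<notin> ball s r"
        using r(2) True by (auto simp: A_def)
      moreover have "dist s (1 - of_nat k) \<le> dist s y + dist y (1 - of_nat k)"
        by (rule dist_triangle)
      ultimately have "r / 2 \<le> norm (y + of_nat k - 1)"
        using y by (simp add: dist_norm algebra_simps)
      moreover from this have "(r / 2)^2 \<le> norm (y + of_nat k - 1)^2"
        using r by (intro power_mono) auto
      ultimately have "norm (p k) / norm (y + of_nat k - 1)^2 + norm (q k) / norm (y + of_nat k - 1) \<le> h k"
        unfolding h_def using r(1) by (intro add_mono divide_left_mono mult_pos_pos) auto
      moreover have "norm (f k y) \<le> norm (p k) / norm (y + of_nat k - 1)^2 + norm (q k) / norm (y + of_nat k - 1)"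
        unfolding f_def by (rule norm_triangle_le) (simp add: norm_divide norm_power)
      ultimately show ?thesis by linarith
    qed (auto simp: f_def h_def)
    moreover have "summable h"
      unfolding h_def using p q by (intro summable_add summable_divide)
    ultimately show "\<exists>d h. 0 < d \<and> summable h \<and> (\<forall>\<^sub>F n in sequentially. \<forall>y\<in>ball s d \<inter> A. norm (f n y) \<le> h n)"
      using r(1) by (intro exI[of _ "r/2"] exI[of _ h]) auto
  qed
  then obtain S S' where S: "\<And>s. s \<in> A \<Longrightarrow> (\<lambda>k. f k s) sums S s"
      "\<And>s. s \<in> A \<Longrightarrow> (S has_field_derivative S' s) (at s)"
    by blast
  from S(2) have "S holomorphic_on A"
    using A holomorphic_on_open by blast
  with S(1) show ?thesis unfolding f_def by blast
qed

text \<open>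
  Zeroing the coefficients with index \<open>m\<close> gives a series of the same kind that has no pole at
  \<open>1 - of_nat m\<close>.
\<close>

lemma partial_fraction_series_principal_part:
  fixes p q :: "nat \<Rightarrow> complex"
  assumes p: "summable (\<lambda>k. norm (p k))" and q: "summable (\<lambda>k. norm (q k))"
    and S: "\<And>s. s \<notin> {1 - of_nat k | k. p k \<noteq> 0 \<or> q k \<noteq> 0} \<Longrightarrow>
              (\<lambda>k. p k / (s + of_nat k - 1)\<^sup>2 + q k / (s + of_nat k - 1)) sums S s"
  shows "\<exists>R. R holomorphic_on ball (1 - of_nat m) 1 \<and>
           (\<forall>s\<in>ball (1 - of_nat m) 1 - {1 - of_nat m}.
              S s = p m / (s - (1 - of_nat m))\<^sup>2 + q m / (s - (1 - of_nat m)) + R s)"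
proof -
  define p' where "p' = p(m := 0)"
  define q' where "q' = q(m := 0)"
  define s0 :: complex where "s0 = 1 - of_nat m"
  have p': "summable (\<lambda>k. norm (p' k))"
    by (rule summable_comparison_test'[OF p, of 0]) (simp add: p'_def)
  have q': "summable (\<lambda>k. norm (q' k))"
    by (rule summable_comparison_test'[OF q, of 0]) (simp add: q'_def)
  from partial_fraction_series_holomorphic[OF p' q'] obtain R where
    R: "R holomorphic_on - {1 - of_nat k | k. p' k \<noteq> 0 \<or> q' k \<noteq> 0}"
       "\<And>s. s \<notin> {1 - of_nat k | k. p' k \<noteq> 0 \<or> q' k \<noteq> 0} \<Longrightarrow>
           (\<lambda>k. p' k / (s + of_nat k - 1)\<^sup>2 + q' k / (s + of_nat k - 1)) sums R s"
    by blast
  have k_eq: "k = m" if "1 - of_nat k \<in> ball s0 1" for k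
  proof -
    have "norm (of_int (int k - int m) :: complex) < 1"
      using that by (simp add: s0_def dist_norm norm_minus_commute)
    hence "\<bar>real_of_int (int k - int m)\<bar> < 1" by (simp only: norm_of_int)
    thus ?thesis by linarith
  qed
  have sub: "ball s0 1 \<subseteq> - {1 - of_nat k | k. p' k \<noteq> 0 \<or> q' k \<noteq> 0}"
    using k_eq by (auto simp: p'_def q'_def)
  have "S s = p m / (s - s0)\<^sup>2 + q m / (s - s0) + R s" if s: "s \<in> ball s0 1 - {s0}" for s
  proof -
    have "(\<lambda>k. (if k = m then p m / (s - s0)\<^sup>2 + q m / (s - s0) else 0) +
               (p' k / (s + of_nat k - 1)\<^sup>2 + q' k / (s + of_nat k - 1))) sums
            (p m / (s - s0)\<^sup>2 + q m / (s - s0) + R s)"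
      using s sub by (intro sums_add sums_single R(2)) auto
    also have "(\<lambda>k. (if k = m then p m / (s - s0)\<^sup>2 + q m / (s - s0) else 0) +
               (p' k / (s + of_nat k - 1)\<^sup>2 + q' k / (s + of_nat k - 1))) =
               (\<lambda>k. p k / (s + of_nat k - 1)\<^sup>2 + q k / (s + of_nat k - 1))"
      by (auto simp: fun_eq_iff p'_def q'_def s0_def algebra_simps)
    finally have "(\<lambda>k. p k / (s + of_nat k - 1)\<^sup>2 + q k / (s + of_nat k - 1)) sums
            (p m / (s - s0)\<^sup>2 + q m / (s - s0) + R s)" .
    moreover have "s \<notin> {1 - of_nat k | k. p k \<noteq> 0 \<or> q k \<noteq> 0}"
      using s k_eq by (auto simp: s0_def)
    ultimately show ?thesis
      using S sums_unique2 by blast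
  qed
  with holomorphic_on_subset[OF R(1) sub] show ?thesis
    unfolding s0_def by blast
qed

section \<open>Bernoulli polynomials at one half\<close>

definition bernoulli_half_fps :: "complex fps" where
  "bernoulli_half_fps = Abs_fps (\<lambda>m. bernoulli_poly m (1 / 2) / fact m)"

lemma bernoulli_half_fps_eq:
  "bernoulli_half_fps * (fps_exp (1 / 2) - fps_exp (- (1 / 2))) = fps_X"
proof -
  define f where "f = (\<lambda>z::complex. if z = 0 then bernoulli_poly 0 (1 / 2) else z * exp (1 / 2 * z) / (exp z - 1))"
  have "f has_fps_expansion bernoulli_half_fps"
  proof (rule has_fps_expansionI)
    have "eventually (\<lambda>z::complex. z \<in> ball 0 (2 * pi)) (nhds 0)"
      by (intro eventually_nhds_in_open) auto
    thus "eventually (\<lambda>z. (\<lambda>n. fps_nth bernoulli_half_fps n * z ^ n) sums f z) (nhds 0)"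
    proof eventually_elim
      case (elim z)
      show ?case
      proof (cases "z = 0")
        case True
        thus ?thesis
          using powser_sums_zero[of "\<lambda>n. fps_nth bernoulli_half_fps n"] by (simp add: f_def bernoulli_half_fps_def)
      next
        case False
        thus ?thesis
          using is_bernoulli_seq_bernoulli_poly[of "1/2"] elim
          by (simp add: f_def is_bernoulli_seq_def bernoulli_half_fps_def)
      qed
    qed
  qed
  hence exp1: "(\<lambda>z. f z * (exp (1/2 * z) - exp (-(1/2) * z))) has_fps_expansion
          bernoulli_half_fps * (fps_exp (1 / 2) - fps_exp (- (1 / 2)))"
    by (intro has_fps_expansion_mult has_fps_expansion_diff has_fps_expansion_exp)
  have "eventually (\<lambda>z::complex. z \<in> ball 0 (2 * pi)) (nhds 0)"
    by (intro eventually_nhds_in_open) auto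
  hence "eventually (\<lambda>z. f z * (exp (1/2 * z) - exp (-(1/2) * z)) = z) (nhds 0)"
  proof eventually_elim
    case (elim z)
    have e: "exp z = exp (z / 2) * exp (z / 2)" by (simp flip: exp_add)
    have "exp (z / 2) * exp (z / 2) \<noteq> 1" if "z \<noteq> 0"
      using exp_eq_1_small[of z] elim that e by auto
    thus ?case
      by (auto simp: f_def e exp_minus field_simps)
  qed
  hence "(\<lambda>z. z) has_fps_expansion bernoulli_half_fps * (fps_exp (1 / 2) - fps_exp (- (1 / 2)))"
    using exp1 by (subst (asm) has_fps_expansion_cong) auto
  thus ?thesis
    using fps_expansion_unique_complex has_fps_expansion_fps_X by blast
qed

lemma fps_nth_X_mult_deriv: "fps_nth (fps_X * fps_deriv f) n = of_nat n * fps_nth f n"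
  by (cases n) auto

text \<open>
  Write \<open>B = X / S\<close> with \<open>S = exp (X/2) - exp (-X/2)\<close>, and let \<open>w = 1 - (X/2) coth (X/2)\<close>. Differentiating gives
  \<open>X B' = B w\<close> and the Riccati equation \<open>X w' = w\<^sup>2 - w - X\<^sup>2/4\<close>. Comparing coefficients, and then
  dividing the \<open>n\<close>-th coefficient by \<open>\<i> ^ n\<close> (which turns \<open>- X\<^sup>2/4\<close> into \<open>+ X\<^sup>2/4\<close>), all terms in the
  resulting recurrences are nonnegative. So the normalised coefficients are nonnegative reals, and
  positive for even indices.
\<close>

lemma bernoulli_half_even_nz:
  assumes n: "even n"
  shows "bernoulli_poly n (1 / 2) \<noteq> 0"
proof -
  define B where "B = bernoulli_half_fps"
  define S :: "complex fps" where "S = fps_exp (1 / 2) - fps_exp (- (1 / 2))"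
  define C :: "complex fps" where "C = fps_exp (1 / 2) + fps_exp (- (1 / 2))"
  define h :: "complex fps" where "h = fps_const (1 / 2)"
  define w where "w = 1 - h * B * C"
  have BS: "B * S = fps_X" using bernoulli_half_fps_eq by (simp add: B_def S_def)
  have dS: "fps_deriv S = h * C" and dC: "fps_deriv C = h * S"
    by (simp_all add: S_def C_def h_def algebra_simps flip: fps_const_neg)
  have "fps_deriv (B * S) = 1" by (simp add: BS)
  hence d1: "fps_deriv B * S + B * (h * C) = 1" by (simp add: dS add.commute)
  have ode1: "fps_X * fps_deriv B = B * w"
    unfolding w_def BS[symmetric] using d1 by algebra
  have "fps_deriv w = - (h * (fps_deriv B * C + B * (h * S)))"
    by (simp add: w_def dC h_def algebra_simps)
  hence ode2: "fps_X * fps_deriv w = w * w - w - h * h * fps_X * fps_X"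
    using ode1 BS unfolding w_def by algebra

  have B0: "fps_nth B 0 = 1"
    using arg_cong[OF BS, of "\<lambda>f. fps_nth f 1"] by (simp add: fps_mult_nth S_def)
  have w0: "fps_nth w 0 = 0"
    by (simp add: w_def B0 C_def h_def)
  have rec_w: "of_nat (Suc n) * fps_nth w n = (\<Sum>i\<le>n. fps_nth w i * fps_nth w (n - i)) - (if n = 2 then 1 / 4 else 0)" for n
  proof -
    have "fps_nth (h * h * fps_X * fps_X) n = (if n = 2 then 1 / 4 else 0)"
      by (cases n; cases "n - 1") (auto simp: h_def mult.assoc numeral_2_eq_2)
    moreover have "fps_nth (fps_X * fps_deriv w) n =
        fps_nth (w * w) n - fps_nth w n - fps_nth (h * h * fps_X * fps_X) n"
      by (simp only: ode2 fps_sub_nth)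
    moreover have "fps_nth (w * w) n = (\<Sum>i\<le>n. fps_nth w i * fps_nth w (n - i))"
      by (simp add: fps_mult_nth atLeast0AtMost)
    ultimately show ?thesis
      unfolding fps_nth_X_mult_deriv by (simp add: algebra_simps)
  qed
  have rec_B: "of_nat n * fps_nth B n = (\<Sum>i\<le>n. fps_nth B i * fps_nth w (n - i))" for n
    unfolding fps_nth_X_mult_deriv[symmetric] ode1 by (simp add: fps_mult_nth atLeast0AtMost)

  \<comment> \<open>division by \<open>\<i> ^ n\<close> passes from hyperbolic to trigonometric functions and removes alternating signs\<close>
  define \<omega> where "\<omega> = (\<lambda>n. fps_nth w n / \<i> ^ n)"
  define \<beta> where "\<beta> = (\<lambda>n. fps_nth B n / \<i> ^ n)"
  have ipow: "\<i> ^ i * \<i> ^ (n - i) = \<i> ^ n" if "i \<le> n" for i n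
    using that by (simp flip: power_add)
  have rec_\<omega>: "of_nat (Suc n) * \<omega> n = (\<Sum>i\<le>n. \<omega> i * \<omega> (n - i)) + (if n = 2 then 1 / 4 else 0)" for n
  proof -
    have "(\<Sum>i\<le>n. \<omega> i * \<omega> (n - i)) = (\<Sum>i\<le>n. fps_nth w i * fps_nth w (n - i)) / \<i> ^ n"
      unfolding sum_divide_distrib \<omega>_def by (intro sum.cong) (auto simp: ipow)
    moreover have "of_nat (Suc n) * \<omega> n = (of_nat (Suc n) * fps_nth w n) / \<i> ^ n"
      by (simp add: \<omega>_def)
    ultimately show ?thesis
      unfolding rec_w by (simp add: diff_divide_distrib)
  qed
  have rec_\<beta>: "of_nat n * \<beta> n = (\<Sum>i\<le>n. \<beta> i * \<omega> (n - i))" for n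
  proof -
    have "(\<Sum>i\<le>n. \<beta> i * \<omega> (n - i)) = (\<Sum>i\<le>n. fps_nth B i * fps_nth w (n - i)) / \<i> ^ n"
      unfolding sum_divide_distrib \<omega>_def \<beta>_def by (intro sum.cong) (auto simp: ipow)
    moreover have "of_nat n * \<beta> n = (of_nat n * fps_nth B n) / \<i> ^ n"
      by (simp add: \<beta>_def)
    ultimately show ?thesis
      unfolding rec_B by simp
  qed
  have \<omega>0: "\<omega> 0 = 0" and \<beta>0: "\<beta> 0 = 1"
    by (simp_all add: \<omega>_def \<beta>_def w0 B0)
  have \<omega>_pos: "\<exists>r\<ge>0. \<omega> n = of_real r \<and> (even n \<longrightarrow> n > 0 \<longrightarrow> r > 0)" for n
  proof (induction n rule: less_induct)
    case (less n)
    have "\<forall>i\<in>{..<n}. \<exists>r\<ge>0. \<omega> i = of_real r \<and> (even i \<longrightarrow> i > 0 \<longrightarrow> r > 0)"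
      using less by blast
    then obtain r where r: "\<And>i. i < n \<Longrightarrow> r i \<ge> 0" "\<And>i. i < n \<Longrightarrow> \<omega> i = of_real (r i)"
        "\<And>i. i < n \<Longrightarrow> even i \<Longrightarrow> i > 0 \<Longrightarrow> r i > 0"
      unfolding bchoice_iff by auto
    show ?case
    proof (cases "n = 0")
      case False
      define T where "T = (\<Sum>i\<in>{0<..<n}. r i * r (n - i)) + (if n = 2 then 1 / 4 else 0)"
      have "(\<Sum>i\<le>n. \<omega> i * \<omega> (n - i)) = (\<Sum>i\<in>{0<..<n}. \<omega> i * \<omega> (n - i))"
        by (rule sum.mono_neutral_right) (auto simp: \<omega>0 not_less Suc_le_eq intro: le_neq_implies_less)
      also have "\<dots> = (\<Sum>i\<in>{0<..<n}. of_real (r i * r (n - i)))"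
        by (intro sum.cong) (auto simp: r(2))
      finally have eq: "\<omega> n = of_real (T / Suc n)"
        using rec_\<omega>[of n] by (simp add: T_def field_simps del: of_nat_Suc)
      have nonneg: "(\<Sum>i\<in>{0<..<n}. r i * r (n - i)) \<ge> 0"
        by (intro sum_nonneg mult_nonneg_nonneg r) auto
      have pos: "T > 0" if "even n"
      proof (cases "n = 2")
        case False
        with that \<open>n \<noteq> 0\<close> have "n > 2" by (auto elim!: evenE)
        \<comment> \<open>for even \<open>n > 2\<close> the product with indices \<open>2\<close> and \<open>n - 2\<close> is already positive\<close>
        have "0 < r 2 * r (n - 2)" using \<open>n > 2\<close> that by (intro mult_pos_pos r(3)) auto
        also have "r 2 * r (n - 2) \<le> (\<Sum>i\<in>{0<..<n}. r i * r (n - i))"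
          using \<open>n > 2\<close> by (intro member_le_sum[of 2 _ "\<lambda>i. r i * r (n - i)"]) (auto intro!: mult_nonneg_nonneg r)
        finally show ?thesis using False by (simp add: T_def)
      qed (use nonneg in \<open>simp add: T_def\<close>)
      show ?thesis
        using eq pos nonneg by (intro exI[of _ "T / Suc n"]) (auto simp: T_def)
    qed (auto simp: \<omega>0)
  qed
  then obtain r where r: "\<And>i. r i \<ge> 0" "\<And>i. \<omega> i = of_real (r i)"
      "\<And>i. even i \<Longrightarrow> i > 0 \<Longrightarrow> r i > 0"
    by metis
  have "\<exists>b\<ge>0. \<beta> n = of_real b \<and> (even n \<longrightarrow> b > 0)" for n
  proof (induction n rule: less_induct)
    case (less n)
    have "\<forall>i\<in>{..<n}. \<exists>b\<ge>0. \<beta> i = of_real b \<and> (even i \<longrightarrow> b > 0)"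
      using less by blast
    then obtain b where b: "\<And>i. i < n \<Longrightarrow> b i \<ge> 0" "\<And>i. i < n \<Longrightarrow> \<beta> i = of_real (b i)"
        "\<And>i. i < n \<Longrightarrow> even i \<Longrightarrow> b i > 0"
      unfolding bchoice_iff by auto
    show ?case
    proof (cases "n = 0")
      case False
      define T where "T = (\<Sum>i<n. b i * r (n - i))"
      have "(\<Sum>i\<le>n. \<beta> i * \<omega> (n - i)) = (\<Sum>i<n. \<beta> i * \<omega> (n - i))"
        by (rule sum.mono_neutral_right) (auto simp: \<omega>0 not_less)
      also have "\<dots> = of_real T"
        unfolding T_def of_real_sum by (intro sum.cong) (auto simp: r(2) b(2))
      finally have eq: "\<beta> n = of_real (T / n)"
        using rec_\<beta>[of n] False by (simp add: field_simps)
      have nonneg: "T \<ge> 0"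
        unfolding T_def by (intro sum_nonneg mult_nonneg_nonneg r b) auto
      have pos: "T > 0" if "even n"
      proof -
        have "0 < b 0 * r (n - 0)" using False that by (intro mult_pos_pos r b) auto
        also have "\<dots> \<le> T"
          unfolding T_def using False by (intro member_le_sum[of 0 _ "\<lambda>i. b i * r (n - i)"]) (auto intro!: mult_nonneg_nonneg r b)
        finally show ?thesis .
      qed
      show ?thesis
        using eq pos nonneg False by (intro exI[of _ "T / n"]) auto
    qed (auto simp: \<beta>0 intro!: exI[of _ 1])
  qed
  from this[of n] n have "\<beta> n \<noteq> 0" by auto
  thus ?thesis by (auto simp: \<beta>_def B_def bernoulli_half_fps_def)
qed

lemma bernoulli_half_0: "bernoulli_poly 0 (1 / 2) = 1"
  using arg_cong[OF bernoulli_half_fps_eq, of "\<lambda>f. fps_nth f 1"]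
  by (simp add: fps_mult_nth bernoulli_half_fps_def)

text \<open>
  The generating function at \<open>x = 1/2\<close> equals \<open>(z/2) / sinh (z/2)\<close>, which is even.
\<close>

lemma bernoulli_half_odd:
  assumes "odd n"
  shows "bernoulli_poly n (1 / 2) = 0"
proof -
  define b where "b = (\<lambda>m. bernoulli_poly m (1 / 2))"
  have b: "is_bernoulli_seq (1 / 2) b"
    unfolding b_def by (rule is_bernoulli_seq_bernoulli_poly)
  have "is_bernoulli_seq (1 / 2) (\<lambda>m. (-1) ^ m * b m)"
    unfolding is_bernoulli_seq_def
  proof (intro allI impI)
    fix z :: complex assume z: "z \<noteq> 0" "norm z < 2 * pi"
    have "(\<lambda>m. b m * (- z) ^ m / fact m) sums ((- z) * exp (1 / 2 * (- z)) / (exp (- z) - 1))"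
      using b[unfolded is_bernoulli_seq_def, rule_format, of "- z"] z by simp
    moreover have "(- z) * exp (1 / 2 * (- z)) / (exp (- z) - 1) = z * exp (1 / 2 * z) / (exp z - 1)"
    proof -
      have e: "exp z = exp (z / 2) * exp (z / 2)" by (simp flip: exp_add)
      have "exp z \<noteq> 1" using exp_eq_1_small[of z] z by auto
      thus ?thesis by (simp add: exp_minus e divide_simps) (simp add: algebra_simps)
    qed
    ultimately show "(\<lambda>m. (-1) ^ m * b m * z ^ m / fact m) sums (z * exp (1 / 2 * z) / (exp z - 1))"
      by (simp add: power_minus[of z] mult_ac)
  qed
  from bernoulli_seq_unique[OF b this] have "b n = (-1) ^ n * b n" by metis
  with assms show ?thesis by (simp add: b_def)
qed

section \<open>The generating function of the odd harmonic numbers\<close>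

text \<open>
  With \<open>y = exp (- t / 2)\<close> this is \<open>y / (1 - y\<^sup>2) * artanh y\<close>.
\<close>

definition odd_harm_gen :: "real \<Rightarrow> real" where
  "odd_harm_gen t = exp (- t / 2) / (1 - exp (- t)) * (ln ((1 + exp (- t / 2)) / (1 - exp (- t / 2))) / 2)"

lemma odd_harm_conv_sum: "odd_harm (Suc n) = (\<Sum>i\<le>n. 1 / (2 * real i + 1))"
  unfolding odd_harm_def by (induction n) (auto simp: algebra_simps)

lemma odd_harm_nonneg: "odd_harm (Suc n) \<ge> 0"
  unfolding odd_harm_conv_sum by (intro sum_nonneg) auto

text \<open>
  In the variable \<open>x = y\<^sup>2 = exp (- t)\<close>, taking partial sums of \<open>1 / (2 i + 1)\<close> is multiplication by the geometric
  series \<open>1 / (1 - x)\<close>, and \<open>\<Sum>i. x ^ i / (2 i + 1)\<close> is \<open>artanh y / y\<close>.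
\<close>

lemma odd_harm_gen_sums:
  assumes t: "t > 0"
  shows "(\<lambda>n. odd_harm (Suc n) * exp (- real (Suc n) * t)) sums odd_harm_gen t"
proof -
  define y where "y = exp (- t / 2)"
  have y: "0 < y" "y < 1" using t by (auto simp: y_def)
  have y2: "exp (- t) = y ^ 2" by (simp add: y_def power2_eq_square flip: exp_add)
  define L where "L = ln ((1 + y) / (1 - y)) / 2"
  have arg: "((1 + y) / (1 - y) - 1) / ((1 + y) / (1 - y) + 1) = y"
    using y by (simp add: field_simps)
  have "(\<lambda>n. 2 * ((((1 + y) / (1 - y)) - 1) / (((1 + y) / (1 - y)) + 1)) ^ (2 * n + 1) / real (2 * n + 1)) sums
          ln ((1 + y) / (1 - y))"
    using y by (intro ln_series_quadratic) auto
  from sums_mult[OF this, of "1 / (2 * y)"]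
  have "(\<lambda>n. 1 / (2 * y) * (2 * y ^ (2 * n + 1) / real (2 * n + 1))) sums (L / y)"
    unfolding arg by (simp add: L_def mult_ac)
  moreover have "1 / (2 * y) * (2 * y ^ (2 * n + 1) / real (2 * n + 1)) = (y\<^sup>2) ^ n / (2 * real n + 1)" for n
    using y by (simp flip: power_mult)
  ultimately have "(\<lambda>n. (y\<^sup>2) ^ n / (2 * real n + 1)) sums (L / y)"
    by simp
  moreover have "(\<lambda>n. (y\<^sup>2) ^ n) sums (1 / (1 - y\<^sup>2))"
    using y by (intro geometric_sums) (auto simp: power_less_one_iff abs_square_less_1)
  ultimately have "(\<lambda>n. \<Sum>i\<le>n. (y\<^sup>2) ^ i / (2 * real i + 1) * (y\<^sup>2) ^ (n - i)) sums
      ((\<Sum>n. (y\<^sup>2) ^ n / (2 * real n + 1)) * (\<Sum>n. (y\<^sup>2) ^ n))"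
    by (intro Cauchy_product_sums) (auto simp: sums_iff abs_mult)
  also have "(\<Sum>n. (y\<^sup>2) ^ n / (2 * real n + 1)) * (\<Sum>n. (y\<^sup>2) ^ n) = (L / y) * (1 / (1 - y\<^sup>2))"
    using \<open>(\<lambda>n. (y\<^sup>2) ^ n / (2 * real n + 1)) sums (L / y)\<close> \<open>(\<lambda>n. (y\<^sup>2) ^ n) sums (1 / (1 - y\<^sup>2))\<close>
    by (simp add: sums_iff)
  also have "(\<lambda>n. \<Sum>i\<le>n. (y\<^sup>2) ^ i / (2 * real i + 1) * (y\<^sup>2) ^ (n - i)) =
             (\<lambda>n. odd_harm (Suc n) * (y\<^sup>2) ^ n)"
    unfolding odd_harm_conv_sum sum_distrib_right
    by (intro ext sum.cong) (auto simp flip: power_add)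
  finally have "(\<lambda>n. y\<^sup>2 * (odd_harm (Suc n) * (y\<^sup>2) ^ n)) sums (y\<^sup>2 * ((L / y) * (1 / (1 - y\<^sup>2))))"
    by (rule sums_mult)
  moreover have "exp (- real (Suc n) * t) = y\<^sup>2 * (y\<^sup>2) ^ n" for n
  proof -
    have "exp (- real (Suc n) * t) = exp (- t) ^ Suc n"
      by (subst exp_of_nat_mult [symmetric]) (simp add: algebra_simps)
    thus ?thesis by (simp add: y2)
  qed
  moreover have "y\<^sup>2 * ((L / y) * (1 / (1 - y\<^sup>2))) = odd_harm_gen t"
    unfolding odd_harm_gen_def y_def[symmetric] y2 L_def using y by (simp add: power2_eq_square)
  ultimately show ?thesis by (simp add: mult_ac)
qed

lemma odd_harm_le: "odd_harm (Suc n) \<le> 1 + ln (real (Suc n))"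
proof (induction n)
  case (Suc n)
  have "ln (1 - 1 / real (Suc (Suc n))) \<le> - (1 / real (Suc (Suc n)))"
    using ln_add_one_self_le_self2[of "- (1 / real (Suc (Suc n)))"] by (simp add: field_simps)
  also have "1 - 1 / real (Suc (Suc n)) = real (Suc n) / real (Suc (Suc n))"
    by (simp add: field_simps)
  also have "ln (real (Suc n) / real (Suc (Suc n))) = ln (real (Suc n)) - ln (real (Suc (Suc n)))"
    by (rule ln_divide_pos) auto
  finally have "1 / real (Suc (Suc n)) \<le> ln (real (Suc (Suc n))) - ln (real (Suc n))" by linarith
  moreover have "odd_harm (Suc (Suc n)) = odd_harm (Suc n) + 1 / (2 * real (Suc n) + 1)"
    by (simp add: odd_harm_conv_sum)
  moreover have "1 / (2 * real (Suc n) + 1) \<le> 1 / real (Suc (Suc n))"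
    by (intro divide_left_mono) auto
  ultimately show ?case using Suc.IH by linarith
qed (simp add: odd_harm_conv_sum)

lemma odd_harm_summable:
  fixes \<sigma> :: real
  assumes "\<sigma> > 1"
  shows "summable (\<lambda>n. odd_harm (Suc n) * exp (- \<sigma> * ln (real (Suc n))))"
proof -
  \<comment> \<open>half of the available exponent absorbs the logarithmic growth of \<open>odd_harm\<close>\<close>
  define e where "e = (\<sigma> - 1) / 2"
  have e: "e > 0" using assms by (simp add: e_def)
  have "summable (\<lambda>n. (1 + 1 / e) * (real (Suc n) powr (e - \<sigma>)))"
    using assms summable_real_powr_iff[of "e - \<sigma>"]
    by (intro summable_mult) (subst summable_Suc_iff, simp add: e_def field_simps)
  thus ?thesis
  proof (rule summable_comparison_test')
    fix n :: nat
    define x where "x = real (Suc n)"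
    have x: "x \<ge> 1" by (simp add: x_def)
    have "odd_harm (Suc n) \<le> 1 + ln x" unfolding x_def by (rule odd_harm_le)
    also have "ln x \<le> x powr e / e" using x e by (rule ln_powr_bound)
    also have "1 + x powr e / e \<le> x powr e + x powr e / e"
      using x e by (intro add_mono ge_one_powr_ge_zero) auto
    also have "\<dots> = (1 + 1 / e) * x powr e" by (simp add: ring_distribs)
    finally have "odd_harm (Suc n) \<le> (1 + 1 / e) * x powr e" by simp
    hence "odd_harm (Suc n) * x powr (- \<sigma>) \<le> (1 + 1 / e) * x powr e * x powr (- \<sigma>)"
      by (intro mult_right_mono) auto
    also have "\<dots> = (1 + 1 / e) * x powr (e - \<sigma>)"
      by (simp add: powr_diff powr_minus divide_inverse)
    finally show "norm (odd_harm (Suc n) * exp (- \<sigma> * ln (real (Suc n)))) \<le> (1 + 1 / e) * (real (Suc n) powr (e - \<sigma>))"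
      using x odd_harm_nonneg[of n] by (simp add: powr_def abs_mult del: of_nat_Suc flip: x_def)
  qed
qed

text \<open>
  The Taylor coefficients of half of the Bernoulli generating function at \<open>x = 1/2\<close>. Up to sign, this half
  is the factor of the logarithm in the expansion of \<open>t * odd_harm_gen t\<close> at \<open>0\<close>.
\<close>

definition bern_coeff :: "nat \<Rightarrow> complex" where
  "bern_coeff k = bernoulli_poly k (1 / 2) / (2 * fact k)"

text \<open>
  For \<open>t > 0\<close>, \<open>t * odd_harm_gen t\<close> is \<open>(t/2) exp (t/2) / (exp t - 1)\<close> times \<open>ln (\<kappa> t) - ln t\<close>, where
  \<open>\<kappa> t = t (exp (t/2) + 1) / (exp (t/2) - 1)\<close>. The function \<open>\<kappa>\<close> extends to a zero-free holomorphic
  function \<open>K\<close> on the disc of radius \<open>2\<pi>\<close>, which thus has a holomorphic logarithm \<open>W\<close>. Its branch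
  does not matter: for real \<open>t \<noteq> 0\<close> in the disc, \<open>Re (W t) = ln \<bar>\<kappa> t\<bar>\<close>, and the coefficients of this real
  power series are the real parts of those of \<open>W\<close>. As \<open>\<kappa>\<close> is even, averaging over \<open>t\<close> and \<open>- t\<close>
  shows that the even coefficients suffice. The constant coefficient is \<open>ln (K 0) = ln 4\<close>.
\<close>

lemma odd_harm_gen_expansion:
  shows "\<exists>q :: nat \<Rightarrow> complex.
    summable (\<lambda>k. norm (bern_coeff k)) \<and> summable (\<lambda>k. norm (q k)) \<and>
    q 0 = of_real (ln 2) \<and> (\<forall>k. odd k \<longrightarrow> q k = 0) \<and>
    (\<forall>t. 0 < t \<longrightarrow> t < 1 \<longrightarrow>
       (\<lambda>k. (q k - bern_coeff k * of_real (ln t)) * of_real t ^ k) sums (of_real t * of_real (odd_harm_gen t)))"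
proof -
  define D :: "complex set" where "D = ball 0 (2 * pi)"
  have D: "t \<in> D" "- t \<in> D" if "norm t < 2 * pi" for t using that by (auto simp: D_def)
  have pi2: "2 < 2 * pi" using pi_gt3 by simp
  have exp_dbl: "exp z = exp (z / 2) * exp (z / 2)" for z :: complex by (simp flip: exp_add)
  have exp_ne: "exp (z / 2) \<noteq> 1" "exp (z / 2) \<noteq> -1" if "z \<in> D" "z \<noteq> 0" for z
    using exp_eq_1_small[of z] that exp_dbl[of z] by (auto simp: D_def)

  \<comment> \<open>dividing by \<open>E\<close> instead of \<open>(exp (z / 2) - 1) / z\<close> makes \<open>K\<close> holomorphic at \<open>0\<close>\<close>
  define E where "E = (\<lambda>z::complex. if z = 0 then 1 / 2 else (exp (z / 2) - 1) / z)"
  have "((\<lambda>z::complex. exp (z / 2)) has_field_derivative 1 / 2) (at 0)"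
    by (auto intro!: derivative_eq_intros)
  hence "((\<lambda>z::complex. (exp (z / 2) - 1) / z) \<longlongrightarrow> 1 / 2) (at 0)"
    by (simp add: DERIV_def)
  hence E_hol: "E holomorphic_on D"
    unfolding E_def by (intro removable_singularity) (auto simp: D_def intro!: holomorphic_intros)
  have E_nz: "E z \<noteq> 0" if "z \<in> D" for z
    using exp_ne[OF that] by (auto simp: E_def)

  define K where "K = (\<lambda>z. (exp (z / 2) + 1) / E z)"
  have K_hol: "K holomorphic_on D"
    unfolding K_def using E_nz E_hol by (intro holomorphic_intros) auto
  have K_nz: "K z \<noteq> 0" if "z \<in> D" for z
    using exp_ne(2)[OF that] E_nz[OF that] by (cases "z = 0") (auto simp: K_def add_eq_0_iff2)
  obtain W where W_hol: "W holomorphic_on D" and W: "\<And>z. z \<in> D \<Longrightarrow> K z = exp (W z)"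
    using contractible_imp_holomorphic_log[OF K_hol _ K_nz] convex_imp_contractible[of D]
    by (auto simp: D_def)

  define \<kappa> where "\<kappa> = (\<lambda>t::real. t * (exp (t / 2) + 1) / (exp (t / 2) - 1))"
  have \<kappa>_pos: "\<kappa> t > 0" if "t > 0" for t
    using that by (auto simp: \<kappa>_def intro!: divide_pos_pos mult_pos_pos add_pos_pos)
  have K_real: "K (of_real t) = of_real (\<kappa> t)" if "t \<noteq> 0" for t
    using that by (simp add: K_def E_def \<kappa>_def flip: exp_of_real)
  have \<kappa>_even: "\<kappa> (- t) = \<kappa> t" for t
    by (auto simp: \<kappa>_def exp_minus divide_simps) (auto simp: algebra_simps)
  have Re_W: "Re (W (of_real t)) = ln \<bar>\<kappa> t\<bar>" if "t \<noteq> 0" "\<bar>t\<bar> < 2 * pi" for t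
  proof -
    have "exp (Re (W (of_real t))) = norm (K (of_real t))"
      using that by (subst W) (auto simp: D_def norm_exp_eq_Re)
    thus ?thesis using K_real[OF that(1)] by (metis ln_exp norm_of_real)
  qed
  define w where "w = (\<lambda>n. (deriv ^^ n) W 0 / fact n)"
  have W_sums: "(\<lambda>n. w n * z ^ n) sums W z" if "z \<in> D" for z
    using holomorphic_power_series[OF W_hol[unfolded D_def], of z] that by (simp add: w_def D_def)
  define r where "r = (\<lambda>n. complex_of_real (if even n then Re (w n) else 0))"
  have Re_sums: "(\<lambda>n. Re (w n) * t ^ n) sums Re (W (of_real t))" if "\<bar>t\<bar> < 2 * pi" for t
    using sums_Re[OF W_sums[of "of_real t"]] that by (simp add: D_def flip: of_real_power)
  have r_sums: "(\<lambda>n. r n * of_real t ^ n) sums of_real (ln (\<kappa> t))" if t: "0 < t" "t < 2 * pi" for t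
  proof -
    have "(\<lambda>n. (Re (w n) * t ^ n + Re (w n) * (- t) ^ n) / 2) sums ((Re (W (of_real t)) + Re (W (of_real (- t)))) / 2)"
      using t by (intro sums_divide sums_add Re_sums) auto
    also have "(Re (W (of_real t)) + Re (W (of_real (- t)))) / 2 = ln (\<kappa> t)"
      using t \<kappa>_pos[of t] by (subst (1 2) Re_W) (auto simp: \<kappa>_even)
    also have "(\<lambda>n. (Re (w n) * t ^ n + Re (w n) * (- t) ^ n) / 2) =
               (\<lambda>n. (if even n then Re (w n) else 0) * t ^ n)"
      by (auto simp: fun_eq_iff power_minus')
    finally have "(\<lambda>n. complex_of_real ((if even n then Re (w n) else 0) * t ^ n)) sums of_real (ln (\<kappa> t))"
      by (rule sums_of_real)
    thus ?thesis by (simp only: r_def of_real_mult of_real_power)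
  qed
  \<comment> \<open>absolute convergence at \<open>1\<close> follows from convergence at \<open>2 < 2\<pi>\<close>\<close>
  have r_summable: "summable (\<lambda>n. norm (r n * z ^ n))" if "norm z \<le> 1" for z
    by (rule powser_insidea[of r "of_real 2"]) (use r_sums[of 2] pi2 that in \<open>auto simp: sums_iff\<close>)
  have r0: "r 0 = of_real (ln 4)"
  proof -
    have "exp (W 0) = 4" using W[of 0] D[of 0] by (simp add: K_def E_def)
    hence "exp (Re (W 0)) = 4" by (metis norm_exp_eq_Re norm_numeral)
    hence "Re (W 0) = ln 4" by (metis ln_exp)
    moreover have "w 0 = W 0" by (simp add: w_def)
    ultimately show ?thesis by (simp add: r_def)
  qed

  have p_sums: "(\<lambda>n. bern_coeff n * of_real t ^ n) sums of_real (t * exp (t / 2) / (exp t - 1) / 2)" if t: "0 < t" "t < 2 * pi" for t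
  proof -
    have "(\<lambda>m. bernoulli_poly m (1 / 2) * of_real t ^ m / fact m) sums
            (of_real t * exp (1 / 2 * of_real t) / (exp (of_real t) - 1))"
      using is_bernoulli_seq_bernoulli_poly[of "1/2", unfolded is_bernoulli_seq_def, rule_format, of "of_real t"] t
      by simp
    from sums_divide[OF this, of 2] show ?thesis
      by (simp add: bern_coeff_def mult_ac flip: exp_of_real)
  qed
  have p_summable: "summable (\<lambda>n. norm (bern_coeff n * z ^ n))" if "norm z \<le> 1" for z
    by (rule powser_insidea[of bern_coeff "of_real 2"]) (use p_sums[of 2] pi2 that in \<open>auto simp: sums_iff\<close>)

  define q where "q = (\<lambda>n. \<Sum>i\<le>n. bern_coeff i * r (n - i))"
  have q_summable: "summable (\<lambda>n. norm (q n))"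
  proof (rule summable_comparison_test')
    show "summable (\<lambda>n. \<Sum>i\<le>n. norm (bern_coeff i) * norm (r (n - i)))"
      using p_summable[of 1] r_summable[of 1] by (intro summable_Cauchy_product) auto
    show "norm (norm (q n)) \<le> (\<Sum>i\<le>n. norm (bern_coeff i) * norm (r (n - i)))" for n
      unfolding q_def by (auto intro!: sum_norm_le simp: norm_mult)
  qed
  have q_odd: "q k = 0" if "odd k" for k
    unfolding q_def
  proof (rule sum.neutral, safe)
    fix i assume "i \<le> k"
    with that have "odd i \<or> odd (k - i)" by auto
    thus "bern_coeff i * r (k - i) = 0"
      using bernoulli_half_odd[of i] by (auto simp: bern_coeff_def r_def)
  qed
  have ln4: "ln (4::real) = 2 * ln 2" using ln_realpow[of 2 2] by simp
  have q0: "q 0 = of_real (ln 2)"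
    by (simp add: q_def bern_coeff_def bernoulli_half_0 r0 ln4)
  have main: "(\<lambda>k. (q k - bern_coeff k * of_real (ln t)) * of_real t ^ k) sums (of_real t * of_real (odd_harm_gen t))"
    if t: "0 < t" "t < 1" for t
  proof -
    have t': "t < 2 * pi" using t pi2 by simp
    define F where "F = t * exp (t / 2) / (exp t - 1) / 2"
    have "(\<lambda>n. \<Sum>i\<le>n. (bern_coeff i * of_real t ^ i) * (r (n - i) * of_real t ^ (n - i))) sums
            ((\<Sum>n. bern_coeff n * of_real t ^ n) * (\<Sum>n. r n * of_real t ^ n))"
      using t by (intro Cauchy_product_sums p_summable r_summable) auto
    also have "(\<Sum>n. bern_coeff n * of_real t ^ n) * (\<Sum>n. r n * of_real t ^ n) = of_real (F * ln (\<kappa> t))"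
      using p_sums[OF t(1) t'] r_sums[OF t(1) t'] by (simp add: sums_iff F_def)
    also have "(\<lambda>n. \<Sum>i\<le>n. (bern_coeff i * of_real t ^ i) * (r (n - i) * of_real t ^ (n - i))) = (\<lambda>n. q n * of_real t ^ n)"
      unfolding q_def sum_distrib_right
      by (intro ext sum.cong) (auto simp: mult_ac simp flip: power_add)
    finally have "(\<lambda>n. q n * of_real t ^ n - of_real (ln t) * (bern_coeff n * of_real t ^ n)) sums
                    (of_real (F * ln (\<kappa> t)) - of_real (ln t) * of_real F)"
      unfolding F_def by (intro sums_diff sums_mult p_sums t t')
    also have "complex_of_real (F * ln (\<kappa> t)) - of_real (ln t) * of_real F = of_real (F * (ln (\<kappa> t) - ln t))"
      by (simp add: algebra_simps)
    also have "ln (\<kappa> t) - ln t = ln (\<kappa> t / t)"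
      using t \<kappa>_pos[of t] by (simp add: ln_div)
    also have "\<kappa> t / t = (1 + exp (- t / 2)) / (1 - exp (- t / 2))"
      using t by (simp add: \<kappa>_def exp_minus divide_simps)
    also have "F * ln ((1 + exp (- t / 2)) / (1 - exp (- t / 2))) = t * odd_harm_gen t"
    proof -
      have eq: "exp (t / 2) / (exp t - 1) = exp (- t / 2) / (1 - exp (- t))"
      proof -
        have e: "exp t = exp (t / 2) * exp (t / 2)" by (simp flip: exp_add)
        have "exp t \<noteq> 1" using t by simp
        thus ?thesis by (simp add: exp_minus e divide_simps)
      qed
      have F_eq: "F = t * (exp (- t / 2) / (1 - exp (- t))) / 2"
        by (subst eq [symmetric]) (simp add: F_def)
      show ?thesis
        unfolding F_eq odd_harm_gen_def by (simp add: mult_ac)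
    qed
    finally show ?thesis by (simp add: algebra_simps)
  qed
  show ?thesis
    by (rule exI[of _ q]) (use p_summable[of 1] q_summable q_odd q0 main in auto)
qed

section \<open>Continuation and poles\<close>

text \<open>
  \<open>T\<close> continues the Mellin integral: its value is the sum of the partial fraction series coming
  from \<open>{0<..<1}\<close> and of the entire integral over \<open>{1..}\<close>. The odd coefficients vanish, so poles can occur
  only at \<open>1\<close> and at the negative odd integers.
\<close>

lemma odd_harm_mellin_continuation:
  shows "\<exists>q T. q 0 = of_real (ln 2) \<and>
    T holomorphic_on - ({1} \<union> {1 - 2 * of_nat n | n :: nat. n \<ge> 1}) \<and>
    (\<forall>m. \<exists>R. R holomorphic_on ball (1 - of_nat m) 1 \<and>
           (\<forall>s\<in>ball (1 - of_nat m) 1 - {1 - of_nat m}.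
              T s = bern_coeff m / (s - (1 - of_nat m))\<^sup>2 + q m / (s - (1 - of_nat m)) + R s)) \<and>
    (\<forall>s. Re s > 1 \<longrightarrow>
       (\<lambda>n. of_real (odd_harm (Suc n)) * of_nat (Suc n) powr (- s) * Gamma s) sums T s)"
proof -
  obtain q where bc: "summable (\<lambda>k. norm (bern_coeff k))" and q: "summable (\<lambda>k. norm (q k))"
    and q0: "q 0 = of_real (ln 2)" and q_odd: "\<And>k. odd k \<Longrightarrow> q k = 0"
    and exp: "\<And>t. 0 < t \<Longrightarrow> t < 1 \<Longrightarrow>
       (\<lambda>k. (q k - bern_coeff k * of_real (ln t)) * of_real t ^ k) sums (of_real t * of_real (odd_harm_gen t))"
    using odd_harm_gen_expansion by blast
  define P :: "complex set" where "P = {1 - of_nat k | k. bern_coeff k \<noteq> 0 \<or> q k \<noteq> 0}"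
  obtain S where S_hol: "S holomorphic_on - P"
    and S: "\<And>s. s \<notin> P \<Longrightarrow> (\<lambda>k. bern_coeff k / (s + of_nat k - 1)\<^sup>2 + q k / (s + of_nat k - 1)) sums S s"
    using partial_fraction_series_holomorphic[OF bc q] unfolding P_def by blast
  have P_sub: "P \<subseteq> {1} \<union> {1 - 2 * of_nat n | n :: nat. n \<ge> 1}"
  proof
    fix s assume "s \<in> P"
    then obtain k where k: "s = 1 - of_nat k" "bern_coeff k \<noteq> 0 \<or> q k \<noteq> 0" by (auto simp: P_def)
    hence "even k" using q_odd[of k] bernoulli_half_odd[of k] by (auto simp: bern_coeff_def)
    then obtain n where n: "k = 2 * n" by (elim evenE)
    show "s \<in> {1} \<union> {1 - 2 * of_nat n | n :: nat. n \<ge> 1}"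
      using k(1) by (cases "n = 0") (auto simp: n)
  qed
  have P_Re: "s \<notin> P" if "Re s > 1" for s
    using that by (auto simp: P_def)

  define f where "f = (\<lambda>s t. exp ((s - 1) * of_real (ln t)) * complex_of_real (odd_harm_gen t))"
  have mellin: "set_integrable lborel {0<..} (f s)"
      "(\<lambda>n. of_real (odd_harm (Suc n)) * exp (- s * of_real (ln (real (Suc n)))) * Gamma s) sums
             (LINT t:{0<..}|lborel. f s t)" if s: "Re s > 1" for s
    unfolding f_def
    by (rule dirichlet_series_mellin[OF odd_harm_nonneg _ odd_harm_summable odd_harm_gen_sums]; use s in simp)+
  define H where "H = (\<lambda>s. LINT t:{1..}|lborel. f s t)"
  have H_hol: "H holomorphic_on UNIV"
    unfolding H_def f_def
  proof (rule mellin_tail_entire)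
    fix \<sigma> :: real assume \<sigma>: "\<sigma> > 1"
    have "set_integrable lborel {1..} (f (of_real \<sigma>))"
      by (rule set_integrable_subset[OF mellin(1)]) (use \<sigma> in auto)
    hence "set_integrable lborel {1..} (\<lambda>t. Re (f (of_real \<sigma>) t))"
      unfolding set_integrable_def by (auto dest: integrable_Re)
    moreover have "f (of_real \<sigma>) t = of_real (exp ((\<sigma> - 1) * ln t) * odd_harm_gen t)" for t
      by (simp add: f_def flip: exp_of_real)
    ultimately show "set_integrable lborel {1..} (\<lambda>t. exp ((\<sigma> - 1) * ln t) * odd_harm_gen t)"
      by simp
  qed
  define T where "T = (\<lambda>s. S s + H s)"
  have T_hol: "T holomorphic_on - ({1} \<union> {1 - 2 * of_nat n | n :: nat. n \<ge> 1})"
    unfolding T_def using P_sub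
    by (intro holomorphic_on_add holomorphic_on_subset[OF S_hol] holomorphic_on_subset[OF H_hol]) auto
  have T_pp: "\<exists>R. R holomorphic_on ball (1 - of_nat m) 1 \<and>
           (\<forall>s\<in>ball (1 - of_nat m) 1 - {1 - of_nat m}.
              T s = bern_coeff m / (s - (1 - of_nat m))\<^sup>2 + q m / (s - (1 - of_nat m)) + R s)" for m
  proof -
    obtain R where R: "R holomorphic_on ball (1 - of_nat m) 1"
           "\<forall>s\<in>ball (1 - of_nat m) 1 - {1 - of_nat m}.
              S s = bern_coeff m / (s - (1 - of_nat m))\<^sup>2 + q m / (s - (1 - of_nat m)) + R s"
      using partial_fraction_series_principal_part[OF bc q, of S m] S unfolding P_def by blast
    thus ?thesis
      by (intro exI[of _ "\<lambda>s. R s + H s"])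
         (auto simp: T_def intro!: holomorphic_intros holomorphic_on_subset[OF H_hol])
  qed
  have T_sums: "(\<lambda>n. of_real (odd_harm (Suc n)) * of_nat (Suc n) powr (- s) * Gamma s) sums T s" if s: "Re s > 1" for s
  proof -
    have "{0::real<..} = {0<..<1} \<union> {1..}" by auto
    hence "(LINT t:{0<..}|lborel. f s t) = (LINT t:{0<..<1} \<union> {1..}|lborel. f s t)"
      by simp
    also have "\<dots> = (LINT t:{0<..<1}|lborel. f s t) + H s"
      unfolding H_def
      by (intro set_integral_Un set_integrable_subset[OF mellin(1)[OF s]]) auto
    also have "(LINT t:{0<..<1}|lborel. f s t) = S s"
      unfolding f_def by (rule sums_unique2[OF mellin_head[OF bc q exp s] S[OF P_Re[OF s]]])
    finally have "(LINT t:{0<..}|lborel. f s t) = T s" by (simp add: T_def)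
    moreover have "exp (- s * of_real (ln (real (Suc n)))) = of_nat (Suc n) powr (- s)" for n
      by (simp add: powr_def Ln_of_nat del: of_nat_Suc)
    ultimately show ?thesis using mellin(2)[OF s] by simp
  qed
  show ?thesis
    by (intro exI[of _ q] exI[of _ T] conjI allI impI q0 T_hol T_pp T_sums)
qed

lemma pole_from_quotient:
  assumes N: "N holomorphic_on ball z r" and r: "r > 0" and nz: "N z \<noteq> 0"
    and f: "\<And>s. s \<in> ball z r - {z} \<Longrightarrow> f s = N s / (s - z) ^ Suc n"
  shows "is_pole f z" "zorder f z = - int (Suc n)" "residue f z = (deriv ^^ n) N z / fact n"
proof -
  have ev: "eventually (\<lambda>s. f s = N s / (s - z) ^ Suc n) (at z)"
    unfolding eventually_at_topological using f r by (intro exI[of _ "ball z r"]) auto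
  have "is_pole (\<lambda>s. N s / (s - z) ^ Suc n) z"
    by (rule is_pole_basic[OF N]) (use r nz in auto)
  thus "is_pole f z" using is_pole_cong[OF ev refl] by simp
  show "zorder f z = - int (Suc n)"
    by (rule zorder_eqI[OF _ _ N nz])
       (use r f in \<open>auto simp: power_int_minus divide_inverse simp del: power_Suc of_nat_Suc\<close>)
  have "residue f z = residue (\<lambda>s. N s / (s - z) ^ Suc n) z"
    by (rule residue_cong[OF ev refl])
  also have "\<dots> = (deriv ^^ n) N z / fact n"
    using r by (intro residue_holomorphic_over_power[OF _ _ N]) auto
  finally show "residue f z = (deriv ^^ n) N z / fact n" .
qed

theorem mainTheorem5:
  shows "\<exists>Z :: complex \<Rightarrow> complex.
      (\<forall>s. Re s > 1 \<longrightarrow>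
         (\<lambda>n. of_real (odd_harm (Suc n)) * of_nat (Suc n) powr (- s)) sums Z s) \<and>
      Z holomorphic_on (- ({1} \<union> {1 - 2 * of_nat n | n :: nat. n \<ge> 1})) \<and>
      is_pole Z 1 \<and> zorder Z 1 = -2 \<and>
      residue Z 1 = of_real (- (1 / 2) * Digamma (1 / 2 :: real)) \<and>
      - (1 / 2) * Digamma (1 / 2 :: real) = ln 2 + euler_mascheroni / 2 \<and>
      (\<forall>n :: nat. n \<ge> 1 \<longrightarrow>
         is_pole Z (1 - 2 * of_nat n) \<and> zorder Z (1 - 2 * of_nat n) = -1 \<and>
         residue Z (1 - 2 * of_nat n) = - bernoulli_poly (2 * n) (1 / 2) / (4 * of_nat n)) \<and>
      (\<forall>n :: nat. n \<ge> 1 \<longrightarrow> Z (- 2 * of_nat n) = 0)"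
proof -
  obtain q T where q0: "q 0 = of_real (ln 2)"
    and T_hol: "T holomorphic_on - ({1} \<union> {1 - 2 * of_nat n | n :: nat. n \<ge> 1})"
    and T_pp: "\<And>m. \<exists>R. R holomorphic_on ball (1 - of_nat m) 1 \<and>
           (\<forall>s\<in>ball (1 - of_nat m) 1 - {1 - of_nat m}.
              T s = bern_coeff m / (s - (1 - of_nat m))\<^sup>2 + q m / (s - (1 - of_nat m)) + R s)"
    and T_sums: "\<And>s. Re s > 1 \<Longrightarrow>
       (\<lambda>n. of_real (odd_harm (Suc n)) * of_nat (Suc n) powr (- s) * Gamma s) sums T s"
    using odd_harm_mellin_continuation by blast
  define Z where "Z = (\<lambda>s. rGamma s * T s)"
  have sums: "(\<lambda>n. of_real (odd_harm (Suc n)) * of_nat (Suc n) powr (- s)) sums Z s" if s: "Re s > 1" for s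
  proof -
    have "s \<notin> \<int>\<^sub>\<le>\<^sub>0" using s by (auto elim!: nonpos_Ints_cases)
    hence "Gamma s * rGamma s = 1" by (simp add: rGamma_inverse_Gamma Gamma_eq_zero_iff)
    with sums_mult2[OF T_sums[OF s], of "rGamma s"] show ?thesis
      by (simp add: Z_def mult.assoc mult.commute[of "rGamma s"])
  qed
  have hol: "Z holomorphic_on - ({1} \<union> {1 - 2 * of_nat n | n :: nat. n \<ge> 1})"
    unfolding Z_def using T_hol by (intro holomorphic_intros)
  have zeros: "Z (- 2 * of_nat n) = 0" for n
  proof -
    have "- 2 * of_nat n = - (of_nat (2 * n) :: complex)" by simp
    hence "- 2 * of_nat n \<in> (\<int>\<^sub>\<le>\<^sub>0 :: complex set)" by (metis minus_of_nat_in_nonpos_Ints)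
    hence "rGamma (- 2 * of_nat n :: complex) = 0" by (simp only: rGamma_eq_zero_iff)
    thus ?thesis by (simp only: Z_def mult_zero_left)
  qed
  have digamma: "- (1 / 2) * Digamma (1 / 2 :: real) = ln 2 + euler_mascheroni / 2"
    by (simp add: Digamma_one_half field_simps)

  have pole1: "is_pole Z 1 \<and> zorder Z 1 = -2 \<and> residue Z 1 = of_real (ln 2 + euler_mascheroni / 2)"
  proof -
    obtain R where R: "R holomorphic_on ball 1 1"
      and T: "\<And>s. s \<in> ball 1 1 - {1} \<Longrightarrow> T s = bern_coeff 0 / (s - 1)\<^sup>2 + q 0 / (s - 1) + R s"
      using T_pp[of 0] by auto
    \<comment> \<open>the numerator of \<open>Z\<close> over \<open>(s - 1)\<^sup>2\<close>, whose derivative at \<open>1\<close> is the residue\<close>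
    define N where "N = (\<lambda>s. rGamma s * (bern_coeff 0 + q 0 * (s - 1) + (s - 1)\<^sup>2 * R s))"
    have p0: "bern_coeff 0 = 1 / 2" by (simp add: bern_coeff_def bernoulli_half_0)
    have N_hol: "N holomorphic_on ball 1 1"
      unfolding N_def using R by (intro holomorphic_intros)
    have N1: "N 1 \<noteq> 0" by (simp add: N_def p0)
    have Z_eq: "Z s = N s / (s - 1) ^ Suc 1" if "s \<in> ball 1 1 - {1}" for s
      using that T[OF that] by (simp add: Z_def N_def divide_simps power2_eq_square)
    have "(R has_field_derivative deriv R 1) (at 1)"
      using holomorphic_derivI[OF R, of 1] by simp
    moreover have "(rGamma has_field_derivative euler_mascheroni) (at (1::complex))"
      using has_field_derivative_rGamma_no_nonpos_int[of "1::complex" UNIV] by simp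
    ultimately have "(N has_field_derivative (bern_coeff 0 * euler_mascheroni + q 0)) (at 1)"
      unfolding N_def by (auto intro!: derivative_eq_intros)
    hence "deriv N 1 = of_real (ln 2 + euler_mascheroni / 2)"
      using DERIV_imp_deriv by (fastforce simp: p0 q0)
    with pole_from_quotient[OF N_hol _ N1 Z_eq] show ?thesis by simp
  qed

  have poles: "is_pole Z (1 - 2 * of_nat n) \<and> zorder Z (1 - 2 * of_nat n) = -1 \<and>
         residue Z (1 - 2 * of_nat n) = - bernoulli_poly (2 * n) (1 / 2) / (4 * of_nat n)" if n: "n \<ge> 1" for n
  proof -
    define z :: complex where "z = 1 - 2 * of_nat n"
    define m where "m = 2 * n"
    have z_m: "z = 1 - of_nat m" by (simp add: z_def m_def)
    have z_neg: "z = - of_nat (m - 1)" using n by (simp add: z_m m_def of_nat_diff)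
    obtain R where R: "R holomorphic_on ball z 1"
      and T: "\<And>s. s \<in> ball z 1 - {z} \<Longrightarrow> T s = bern_coeff m / (s - z)\<^sup>2 + q m / (s - z) + R s"
      using T_pp[of m] unfolding z_m by auto
    \<comment> \<open>\<open>G\<close> is the quotient of \<open>rGamma\<close> by its simple zero at \<open>z\<close>\<close>
    define G where "G = (\<lambda>s. if s = z then deriv rGamma z else (rGamma s - rGamma z) / (s - z))"
    have G_hol: "G holomorphic_on ball z 1"
      unfolding G_def by (intro pole_lemma_open holomorphic_intros open_ball)
    have rG0: "rGamma z = 0"
      unfolding z_neg by (simp add: rGamma_eq_zero_iff)
    have rG: "rGamma s = (s - z) * G s" for s
      by (simp add: G_def rG0)
    have Gz: "G z = - fact (m - 1)"
    proof -
      have "(rGamma has_field_derivative (-1) ^ (m - 1) * fact (m - 1)) (at z)"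
        unfolding z_neg by (rule has_field_derivative_rGamma_nonpos_int)
      moreover have "odd (m - 1)" using n by (simp add: m_def)
      ultimately show ?thesis
        using DERIV_imp_deriv by (fastforce simp: G_def)
    qed
    define N where "N = (\<lambda>s. G s * (bern_coeff m + q m * (s - z) + (s - z)\<^sup>2 * R s))"
    have N_hol: "N holomorphic_on ball z 1"
      unfolding N_def using R G_hol by (intro holomorphic_intros)
    have Nz: "N z = - fact (m - 1) * bern_coeff m" by (simp add: N_def Gz)
    have Nz_nz: "N z \<noteq> 0"
      unfolding Nz bern_coeff_def using bernoulli_half_even_nz[of m] by (simp add: m_def)
    have Z_eq: "Z s = N s / (s - z) ^ Suc 0" if "s \<in> ball z 1 - {z}" for s
      using that T[OF that] by (simp add: Z_def N_def rG divide_simps power2_eq_square mult_ac)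
    have "fact m = of_nat m * (fact (m - 1) :: complex)"
      using n by (simp add: m_def fact_reduce)
    hence "N z = - bernoulli_poly m (1 / 2) / (2 * of_nat m)"
      by (simp add: Nz bern_coeff_def)
    also have "2 * of_nat m = (4 * of_nat n :: complex)" by (simp add: m_def)
    finally show ?thesis
      using pole_from_quotient[OF N_hol _ Nz_nz Z_eq] by (simp add: m_def flip: z_def)
  qed
  show ?thesis
    using sums hol zeros digamma pole1 poles by (intro exI[of _ Z]) (simp only: digamma, blast)
qed

end
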